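(* $3/2\leq C^*\leq 6.614$.
   Context: Every Boolean function $f:\{0,1\}^n\to\{0,1\}$ has a unique multilinear representation over $\mathbb{R}$ agreeing with $f$ on $\{0,1\}^n$; $\deg(f)$ is its degree. A variable is relevant if it appears in a monomial with nonzero coefficient; $R(f)$ is the number of relevant variables. $R_d$ is the maximum of $R(f)$ over Boolean functions of degree at most $d$, $C_d=R_d2^{-d}$, and $C^*=\lim_{d\to\infty}C_d$ (the sequence $C_d$ is nondecreasing). *)

theory Defs
  imports Complex_Main
begin

text \<open>A point x of {0,1}^n is encoded as the set of coordinates i < n with x_i = 1,
  i.e. a subset of {0..<n}. A Boolean function on {0,1}^n is f :: nat set => real
  taking values in {0,1} on such subsets.\<close>

definition is_boolean_fun :: "nat \<Rightarrow> (nat set \<Rightarrow> real) \<Rightarrow> bool" where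
  "is_boolean_fun n f \<longleftrightarrow> (\<forall>x. x \<subseteq> {0..<n} \<longrightarrow> f x \<in> {0, 1})"

definition ml_coeff :: "nat \<Rightarrow> (nat set \<Rightarrow> real) \<Rightarrow> nat set \<Rightarrow> real" where
  "ml_coeff n f = (THE c. (\<forall>S. \<not> S \<subseteq> {0..<n} \<longrightarrow> c S = 0) \<and>
     (\<forall>x. x \<subseteq> {0..<n} \<longrightarrow>
        f x = (\<Sum>S\<in>Pow {0..<n}. c S * (\<Prod>i\<in>S. (if i \<in> x then 1 else 0)))))"

definition bdeg :: "nat \<Rightarrow> (nat set \<Rightarrow> real) \<Rightarrow> nat" where
  "bdeg n f = Max (insert 0 {card S | S. S \<subseteq> {0..<n} \<and> ml_coeff n f S \<noteq> 0})"

definition relevant_vars :: "nat \<Rightarrow> (nat set \<Rightarrow> real) \<Rightarrow> nat set" where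
  "relevant_vars n f = {i. i < n \<and> (\<exists>S. i \<in> S \<and> S \<subseteq> {0..<n} \<and> ml_coeff n f S \<noteq> 0)}"

definition num_relevant :: "nat \<Rightarrow> (nat set \<Rightarrow> real) \<Rightarrow> nat" where
  "num_relevant n f = card (relevant_vars n f)"

definition R_max :: "nat \<Rightarrow> real" where
  "R_max d = Sup {real (num_relevant n f) | n f. is_boolean_fun n f \<and> bdeg n f \<le> d}"

definition C_const :: "nat \<Rightarrow> real" where
  "C_const d = R_max d / 2 ^ d"

end

theory Submission
  imports Defs "HOL-Computational_Algebra.Polynomial"
begin

text \<open>Upper bound (Chiarelli, Hatami, Saks). Let \<open>W(f)\<close> be the sum of
  \<open>2\<close> to the power \<open>-deg\<^sub>i(f)\<close> over the relevant variables \<open>i\<close>, where \<open>deg\<^sub>i(f)\<close> is the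
  largest degree of a monomial containing \<open>i\<close>; then \<open>R(f) \<le> 2\<^sup>d W(f)\<close>. Restricting one variable
  does not decrease the average contribution of the others to \<open>W\<close>, so restricting a set \<open>H\<close>
  that meets all monomials of degree \<open>d\<close> gives \<open>W\<^sub>d \<le> W\<^sub>d\<^sub>-\<^sub>1 + card H / 2\<^sup>d\<close>. A maximal family
  of disjoint monomials of degree \<open>d\<close> yields such an \<open>H\<close>; each of its members contains a block
  to which \<open>f\<close> is sensitive at \<open>0\<close>, and block sensitivity is at most \<open>d\<^sup>2\<close>, so \<open>card H \<le> d\<^sup>3\<close>.
  For small \<open>d\<close> one uses \<open>W\<^sub>d \<le> d / 2\<close> instead, which follows from the fact that the
  total influence is at most \<open>d\<close>.

  Lower bound: \<open>R\<^sub>d\<^sub>+\<^sub>1 \<ge> 2 R\<^sub>d + 2\<close>, which also makes \<open>C\<^sub>d\<close> increasing.\<close>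

section \<open>Multilinear coefficients and degree\<close>

text \<open>Moebius inversion on the subset lattice. Only the values of \<open>f\<close> on subsets
  of \<open>S\<close> enter, so no ambient cube is fixed. The exponent
  \<open>card S + card T\<close> has the parity of the difference and avoids truncated
  subtraction.\<close>

definition mcoeff :: "('a set \<Rightarrow> real) \<Rightarrow> 'a set \<Rightarrow> real" where
  "mcoeff f S = (\<Sum>T\<in>Pow S. (-1) ^ (card S + card T) * f T)"

definition deg_on :: "'a set \<Rightarrow> nat \<Rightarrow> ('a set \<Rightarrow> real) \<Rightarrow> bool" where
  "deg_on V d f \<longleftrightarrow> (\<forall>S. S \<subseteq> V \<longrightarrow> mcoeff f S \<noteq> 0 \<longrightarrow> card S \<le> d)"

definition bool_on :: "'a set \<Rightarrow> ('a set \<Rightarrow> real) \<Rightarrow> bool" where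
  "bool_on V f \<longleftrightarrow> (\<forall>x. x \<subseteq> V \<longrightarrow> f x \<in> {0, 1})"

lemma sum_Pow_insert:
  assumes "finite S" "h \<notin> S"
  shows "(\<Sum>T\<in>Pow (insert h S). F T) = (\<Sum>T\<in>Pow S. F T + (F (insert h T) :: real))"
proof -
  have inj: "inj_on (insert h) (Pow S)"
    using assms by (auto simp: inj_on_def)
  have "(\<Sum>T\<in>Pow (insert h S). F T) = (\<Sum>T\<in>Pow S. F T) + (\<Sum>T\<in>insert h ` Pow S. F T)"
    unfolding Pow_insert using assms by (intro sum.union_disjoint) auto
  then show ?thesis
    using inj by (simp add: sum.reindex sum.distrib)
qed

lemma mcoeff_empty [simp]: "mcoeff f {} = f {}"
  by (simp add: mcoeff_def)

text \<open>Adding \<open>h\<close> to a monomial amounts to differentiating in direction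
  \<open>h\<close>. This recursion drives the later inductions over the variables.\<close>

lemma mcoeff_insert:
  assumes "finite S" "h \<notin> S"
  shows "mcoeff f (insert h S) = mcoeff (\<lambda>x. f (insert h x)) S - mcoeff f S"
proof -
  have "card (insert h T) = Suc (card T)" if "T \<subseteq> S" for T
    using that assms by (metis card_insert_disjoint finite_subset subsetD)
  then show ?thesis
    unfolding mcoeff_def sum_Pow_insert[OF assms] using assms
    by (simp add: sum.distrib sum_subtractf sum_negf)
qed

lemma mcoeff_linear:
  "mcoeff (\<lambda>x. a * f x + b * g x) S = a * mcoeff f S + b * mcoeff g S"
  by (simp add: mcoeff_def sum.distrib sum_distrib_left algebra_simps)

lemma mcoeff_cong:
  assumes "\<And>x. x \<subseteq> S \<Longrightarrow> f x = g x"
  shows "mcoeff f S = mcoeff g S"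
  unfolding mcoeff_def using assms by (intro sum.cong) auto

lemma sum_mcoeff: "finite x \<Longrightarrow> (\<Sum>S\<in>Pow x. mcoeff f S) = f x"
proof (induction x arbitrary: f rule: finite_induct)
  case (insert h x)
  have "(\<Sum>S\<in>Pow (insert h x). mcoeff f S) = (\<Sum>S\<in>Pow x. mcoeff (\<lambda>x. f (insert h x)) S)"
    unfolding sum_Pow_insert[OF insert.hyps]
  proof (rule sum.cong)
    fix S assume "S \<in> Pow x"
    then have "finite S" "h \<notin> S" using insert.hyps finite_subset by auto
    then show "mcoeff f S + mcoeff f (insert h S) = mcoeff (\<lambda>x. f (insert h x)) S"
      by (simp add: mcoeff_insert)
  qed simp
  then show ?case using insert.IH by simp
qed simp

text \<open>The uniqueness half of the multilinear representation; \<open>sum_mcoeff\<close> is the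
  existence half.\<close>

lemma mcoeff_unique: "finite S \<Longrightarrow> mcoeff (\<lambda>x. \<Sum>T\<in>Pow x. c T) S = c S"
proof (induction S arbitrary: c rule: finite_induct)
  case (insert h S)
  have "mcoeff (\<lambda>x. \<Sum>T\<in>Pow (insert h x). c T) S
      = mcoeff (\<lambda>x. \<Sum>T\<in>Pow x. c T + c (insert h T)) S"
    using insert.hyps by (intro mcoeff_cong sum_Pow_insert) (auto intro: finite_subset)
  then show ?case
    using insert by (simp add: mcoeff_insert)
qed simp

lemma mcoeff_all_zero:
  assumes "finite V" "\<And>S. S \<subseteq> V \<Longrightarrow> mcoeff f S = 0" "x \<subseteq> V"
  shows "f x = 0"
proof -
  have "(\<Sum>S\<in>Pow x. mcoeff f S) = 0"
    using assms by (intro sum.neutral) auto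
  then show ?thesis
    using sum_mcoeff assms finite_subset by metis
qed

text \<open>A syntactic counterpart of \<open>deg_on\<close>: a sum of small monomials, considered
  on all sets and not only on subsets of a finite \<open>V\<close>. Closure under products and
  substitution is then a plain induction.\<close>

inductive deg_le :: "nat \<Rightarrow> ('a set \<Rightarrow> real) \<Rightarrow> bool" for d where
  monom: "finite S \<Longrightarrow> card S \<le> d \<Longrightarrow> deg_le d (\<lambda>x. c * of_bool (S \<subseteq> x))"
| add: "deg_le d f \<Longrightarrow> deg_le d g \<Longrightarrow> deg_le d (\<lambda>x. f x + g x)"

lemma deg_le_mono: "deg_le d f \<Longrightarrow> d \<le> e \<Longrightarrow> deg_le e f"
  by (induction rule: deg_le.induct) (auto intro: deg_le.intros)

lemma deg_le_const: "deg_le d (\<lambda>x. c)"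
  using monom[of "{}" d c] by simp

lemma deg_le_var: "1 \<le> d \<Longrightarrow> deg_le d (\<lambda>x. of_bool (i \<in> x))"
  using monom[of "{i}" d 1] by simp

lemma deg_le_cmult: "deg_le d f \<Longrightarrow> deg_le d (\<lambda>x. c * f x)"
proof (induction rule: deg_le.induct)
  case (monom S b)
  then show ?case using deg_le.monom[of S d "c * b"] by (simp add: mult.assoc)
next
  case (add f g)
  then show ?case using deg_le.add by (simp add: distrib_left)
qed

lemma deg_le_diff: "deg_le d f \<Longrightarrow> deg_le d g \<Longrightarrow> deg_le d (\<lambda>x. f x - g x)"
  using add[of d f "\<lambda>x. (-1) * g x"] deg_le_cmult[of d g "-1"] by simp

lemma deg_le_mult:
  assumes "deg_le d f" "deg_le e g"
  shows "deg_le (d + e) (\<lambda>x. f x * g x)"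
  using assms(1)
proof (induction rule: deg_le.induct)
  case (monom S b)
  show ?case using assms(2)
  proof (induction rule: deg_le.induct)
    case (monom T c)
    have "card (S \<union> T) \<le> d + e"
      using card_Un_le[of S T] monom \<open>card S \<le> d\<close> by linarith
    then have "deg_le (d + e) (\<lambda>x. (b * c) * of_bool (S \<union> T \<subseteq> x))"
      using monom \<open>finite S\<close> by (intro deg_le.monom) auto
    \<comment> \<open>Variables are 0/1-valued, hence idempotent: the product of two monomials is
      the monomial of the union.\<close>
    moreover have "(\<lambda>x. (b * c) * of_bool (S \<union> T \<subseteq> x))
        = (\<lambda>x. b * of_bool (S \<subseteq> x) * (c * of_bool (T \<subseteq> x)))"
      by (auto simp: fun_eq_iff)
    ultimately show ?case by simp
  next
    case (add f g)
    then show ?case using deg_le.add by (simp add: distrib_left)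
  qed
next
  case (add f g)
  then show ?case using deg_le.add by (simp add: distrib_right)
qed

lemma deg_le_sum:
  "finite A \<Longrightarrow> (\<And>i. i \<in> A \<Longrightarrow> deg_le d (f i)) \<Longrightarrow> deg_le d (\<lambda>x. \<Sum>i\<in>A. f i x)"
  by (induction A rule: finite_induct) (auto intro: deg_le_const add)

lemma deg_le_prod:
  "finite A \<Longrightarrow> (\<And>i. i \<in> A \<Longrightarrow> deg_le e (f i)) \<Longrightarrow> deg_le (card A * e) (\<lambda>x. \<Prod>i\<in>A. f i x)"
proof (induction A rule: finite_induct)
  case (insert i A)
  then show ?case using deg_le_mult[of e "f i" "card A * e"] by simp
qed (simp add: deg_le_const)

text \<open>Because the \<open>h i\<close> are 0/1-valued, the monomial of \<open>S\<close> turns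
  into the product of the \<open>h i\<close> over \<open>S\<close>, of degree at most
  \<open>card S * e\<close>. A monomial with a variable outside \<open>V\<close> turns into
  0.\<close>

lemma deg_le_subst:
  assumes "deg_le d g"
    and h: "\<And>i. i \<in> V \<Longrightarrow> deg_le e (h i)"
    and bool: "\<And>i x. i \<in> V \<Longrightarrow> h i x \<in> {0, 1}"
  shows "deg_le (d * e) (\<lambda>x. g {i \<in> V. h i x = 1})"
  using assms(1)
proof (induction rule: deg_le.induct)
  case (monom S c)
  show ?case
  proof (cases "S \<subseteq> V")
    case True
    have "of_bool (S \<subseteq> {i \<in> V. h i x = 1}) = (\<Prod>i\<in>S. h i x)" for x
    proof (cases "\<forall>i\<in>S. h i x = 1")
      case False
      then obtain i where "i \<in> S" "h i x = 0" using bool True by fastforce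
      then have "(\<Prod>i\<in>S. h i x) = 0" using monom by auto
      then show ?thesis using False by auto
    qed (use True in auto)
    moreover have "deg_le (d * e) (\<lambda>x. c * (\<Prod>i\<in>S. h i x))"
      using monom True h
      by (intro deg_le_cmult deg_le_mono[OF deg_le_prod[of S e]]) auto
    ultimately show ?thesis by simp
  next
    case False
    then have "\<not> S \<subseteq> {i \<in> V. h i x = 1}" for x by auto
    then show ?thesis by (simp add: deg_le_const)
  qed
qed (rule deg_le.add)

lemma mcoeff_monom:
  assumes "finite S"
  shows "mcoeff (\<lambda>x. c * of_bool (T \<subseteq> x)) S = (if S = T then c else 0)"
proof -
  \<comment> \<open>Written as a subset sum with a single nonzero term, the monomial falls under
    \<open>mcoeff_unique\<close>.\<close>
  have "mcoeff (\<lambda>x. c * of_bool (T \<subseteq> x)) S = mcoeff (\<lambda>x. \<Sum>U\<in>Pow x. if U = T then c else 0) S"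
  proof (rule mcoeff_cong)
    fix x assume "x \<subseteq> S"
    then have "finite (Pow x)" using assms finite_subset by auto
    then show "c * of_bool (T \<subseteq> x) = (\<Sum>U\<in>Pow x. if U = T then c else 0)"
      by simp
  qed
  then show ?thesis by (simp add: mcoeff_unique[OF assms])
qed

lemma deg_on_of_deg_le:
  assumes "deg_le d g" "finite V" "\<And>x. x \<subseteq> V \<Longrightarrow> f x = g x"
  shows "deg_on V d f"
proof -
  have *: "mcoeff g S = 0" if "finite S" "d < card S" for S
    using assms(1)
  proof (induction rule: deg_le.induct)
    case (monom T c)
    then show ?case using that by (auto simp: mcoeff_monom)
  next
    case (add f g)
    then show ?case using mcoeff_linear[of 1 f 1 g S] by simp
  qed
  show ?thesis unfolding deg_on_def
  proof (intro allI impI)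
    fix S assume S: "S \<subseteq> V" "mcoeff f S \<noteq> 0"
    then have "mcoeff g S \<noteq> 0" using mcoeff_cong[of S f g] assms(3) by auto
    then show "card S \<le> d" using *[of S] S assms(2) finite_subset not_le by blast
  qed
qed

text \<open>The witness is the expansion of \<open>f\<close> over \<open>V\<close>. It may differ
  from \<open>f\<close> off \<open>V\<close>, hence the new function \<open>g\<close>.\<close>

lemma deg_le_of_deg_on:
  assumes "deg_on V d f" "finite V"
  obtains g where "deg_le d g" "\<And>x. x \<subseteq> V \<Longrightarrow> g x = f x"
proof
  let ?g = "\<lambda>x. \<Sum>S | S \<subseteq> V \<and> card S \<le> d. mcoeff f S * of_bool (S \<subseteq> x)"
  show "deg_le d ?g"
    using assms finite_subset[of _ V] by (intro deg_le_sum deg_le.monom) auto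
  fix x assume x: "x \<subseteq> V"
  have "?g x = (\<Sum>S\<in>Pow x. mcoeff f S)"
    using assms x finite_subset[OF x] unfolding deg_on_def
    by (intro sum.mono_neutral_cong) auto
  then show "?g x = f x" using sum_mcoeff x assms finite_subset by metis
qed

section \<open>Sensitivity of low-degree functions\<close>

lemma lagrange_interpolation:
  fixes p :: "'a :: field poly"
  assumes "finite T" "degree p < card T"
  shows "poly p z = (\<Sum>t\<in>T. poly p t * (\<Prod>s\<in>T - {t}. (z - s) / (t - s)))"
proof -
  define q where "q = (\<Sum>t\<in>T. smult (poly p t) (\<Prod>s\<in>T - {t}. smult (1 / (t - s)) [:-s, 1:]))"
  have q: "poly q z = (\<Sum>t\<in>T. poly p t * (\<Prod>s\<in>T - {t}. (z - s) / (t - s)))" for z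
    unfolding q_def by (simp add: poly_sum poly_prod diff_divide_distrib)
  have "degree q \<le> card T - 1" unfolding q_def
  proof (rule degree_sum_le)
    fix t assume t: "t \<in> T"
    have "degree (\<Prod>s\<in>T - {t}. smult (1 / (t - s)) [:-s, 1:])
        \<le> (\<Sum>s\<in>T - {t}. degree (smult (1 / (t - s)) [:-s, 1:]))"
      using assms degree_prod_sum_le[of "T - {t}" "\<lambda>s. smult (1 / (t - s)) [:-s, 1:]"]
      by (simp add: o_def)
    also have "\<dots> \<le> (\<Sum>s\<in>T - {t}. 1)"
      by (intro sum_mono) auto
    also have "\<dots> = card T - 1" using t assms by simp
    finally show "degree (smult (poly p t) (\<Prod>s\<in>T - {t}. smult (1 / (t - s)) [:-s, 1:])) \<le> card T - 1"
      by (meson degree_smult_le order.trans)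
  qed fact
  then have deg: "degree (q - p) < card T"
    using assms by (intro degree_diff_less) auto
  have "poly (q - p) t = 0" if t: "t \<in> T" for t
  proof -
    have zero: "(\<Prod>s\<in>T - {u}. (t - s) / (u - s)) = (if u = t then 1 else 0)" if "u \<in> T" for u
      using t that assms by (auto intro!: prod.neutral)
    have "poly q t = (\<Sum>u\<in>T. if u = t then poly p t else 0)"
      unfolding q by (rule sum.cong) (auto simp: zero)
    then show ?thesis using t assms by simp
  qed
  then have sub: "T \<subseteq> {t. poly (q - p) t = 0}" by auto
  \<comment> \<open>A nonzero difference would have \<open>card T\<close> roots but smaller
    degree.\<close>
  have "q - p = 0"
  proof (rule ccontr)
    assume nz: "q - p \<noteq> 0"
    then have "card T \<le> degree (q - p)"
      using card_mono[OF poly_roots_finite[OF nz] sub] card_poly_roots_bound[OF nz] by linarith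
    then show False using deg by simp
  qed
  then show ?thesis using q[of z] by simp
qed

text \<open>Each factor is the distance of \<open>j\<close> and \<open>i\<close> times their sum.
  The distances multiply to (i-1)! (d-i)!, the sums to (d+i)! / (2 i i!), and the quotient (i-1)! /
  i! leaves 1 / (2 i^2).\<close>

lemma prod_square_diff:
  assumes "1 \<le> i" "i \<le> d"
  shows "2 * real i ^ 2 * (\<Prod>j\<in>{1..d} - {i}. \<bar>real j ^ 2 - real i ^ 2\<bar>) = fact (d - i) * fact (d + i)"
  using assms(2)
proof (induction d rule: dec_induct)
  case base
  \<comment> \<open>For \<open>d = i\<close> the factors with \<open>j < i\<close> are taken in one
    at a time; \<open>m = i\<close> gives the whole product.\<close>
  have "(\<Prod>j\<in>{1..<m}. real i ^ 2 - real j ^ 2) * (fact i * fact (i - m))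
       = fact (i - 1) * fact (i + m - 1)" if "1 \<le> m" "m \<le> i" for m
    using that
  proof (induction m rule: dec_induct)
    case base
    then show ?case using assms by (simp add: fact_reduce)
  next
    case (step m)
    have f1: "fact (i - m) = real (i - m) * fact (i - Suc m)"
      using step by (metis Suc_diff_Suc Suc_le_eq fact_Suc of_nat_fact of_nat_mult)
    have f2: "fact (i + Suc m - 1) = real (i + m) * fact (i + m - 1)"
      using step by (simp add: fact_reduce)
    have "{1..<Suc m} = insert m {1..<m}" using step by auto
    then have "(\<Prod>j\<in>{1..<Suc m}. real i ^ 2 - real j ^ 2) * (fact i * fact (i - Suc m))
       = (real i ^ 2 - real m ^ 2) * ((\<Prod>j\<in>{1..<m}. real i ^ 2 - real j ^ 2) * (fact i * fact (i - Suc m)))"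
      by simp
    also have "\<dots> = real (i + m) * ((\<Prod>j\<in>{1..<m}. real i ^ 2 - real j ^ 2) * (fact i * fact (i - m)))"
      unfolding f1 using step by (simp add: of_nat_diff power2_eq_square algebra_simps)
    also have "\<dots> = fact (i - 1) * fact (i + Suc m - 1)"
      unfolding f2 using step by simp
    finally show ?case .
  qed
  from this[of i] have *: "(\<Prod>j\<in>{1..<i}. real i ^ 2 - real j ^ 2) * fact i = fact (i - 1) * fact (i + i - 1)"
    using assms by simp
  have "(\<Prod>j\<in>{1..i} - {i}. \<bar>real j ^ 2 - real i ^ 2\<bar>) = (\<Prod>j\<in>{1..<i}. real i ^ 2 - real j ^ 2)"
    using assms by (intro prod.cong) (auto simp: power_mono)
  moreover have f1: "fact i = real i * fact (i - 1)" and f2: "fact (i + i) = (2 * real i) * fact (i + i - 1)"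
    using assms by (auto simp: fact_reduce[of i] fact_reduce[of "i + i"])
  moreover have "(\<Prod>j\<in>{1..<i}. real i ^ 2 - real j ^ 2) * real i = fact (i + i - 1)"
    using * unfolding f1 by simp
  ultimately show ?case unfolding f2 by (simp add: power2_eq_square mult_ac)
next
  case (step n)
  have "{1..Suc n} - {i} = insert (Suc n) ({1..n} - {i})" using step by auto
  moreover have "\<bar>real (Suc n) ^ 2 - real i ^ 2\<bar> = real (Suc n - i) * real (Suc n + i)"
  proof -
    have "real (Suc n) ^ 2 - real i ^ 2 = (real (Suc n) - real i) * (real (Suc n) + real i)"
      unfolding power2_eq_square square_diff_square_factored by (rule mult.commute)
    then show ?thesis using step by (simp add: of_nat_diff abs_mult)
  qed
  moreover have "fact (Suc n - i) = real (Suc n - i) * fact (n - i)"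
    using step by (metis Suc_diff_le fact_Suc of_nat_fact of_nat_mult)
  moreover have "fact (Suc n + i) = real (Suc n + i) * fact (n + i)" by simp
  moreover have "(\<Prod>j\<in>insert (Suc n) ({1..n} - {i}). \<bar>real j ^ 2 - real i ^ 2\<bar>)
      = \<bar>real (Suc n) ^ 2 - real i ^ 2\<bar> * (\<Prod>j\<in>{1..n} - {i}. \<bar>real j ^ 2 - real i ^ 2\<bar>)"
    by (rule prod.insert) auto
  ultimately have "2 * real i ^ 2 * (\<Prod>j\<in>{1..Suc n} - {i}. \<bar>real j ^ 2 - real i ^ 2\<bar>)
      = (real (Suc n - i) * real (Suc n + i))
        * (2 * real i ^ 2 * (\<Prod>j\<in>{1..n} - {i}. \<bar>real j ^ 2 - real i ^ 2\<bar>))"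
    by (simp only: mult_ac)
  also have "\<dots> = (real (Suc n - i) * fact (n - i)) * (real (Suc n + i) * fact (n + i))"
    unfolding step.IH by (simp only: mult_ac)
  also have "\<dots> = fact (Suc n - i) * fact (Suc n + i)"
    using \<open>fact (Suc n - i) = real (Suc n - i) * fact (n - i)\<close> by simp
  finally show ?case .
qed

text \<open>This is the maximality of the central binomial coefficient of \<open>2 * d\<close>,
  after cancelling \<open>fact (2 * d)\<close>.\<close>

lemma fact_square_le:
  assumes "i \<le> d"
  shows "(fact d :: real) ^ 2 \<le> fact (d - i) * fact (d + i)"
proof -
  have "2 * d choose (d - i) \<le> (2 * d) choose d" by (rule binomial_maximum')
  then have "real (2 * d choose (d - i)) \<le> real (2 * d choose d)" by simp
  moreover have "real (2 * d choose (d - i)) = fact (2 * d) / (fact (d - i) * fact (d + i))"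
    using assms by (subst binomial_fact) (auto simp: algebra_simps)
  moreover have "real (2 * d choose d) = fact (2 * d) / (fact d * fact d)"
    by (subst binomial_fact) (auto simp: algebra_simps)
  ultimately have "fact (2 * d) / (fact (d - i) * fact (d + i)) \<le> (fact (2 * d) / (fact d * fact d) :: real)"
    by linarith
  moreover have "fact (2 * d) * x \<le> fact (2 * d) * y \<longleftrightarrow> x \<le> (y :: real)" for x y
    by (rule mult_le_cancel_left_pos) simp
  ultimately have "1 / (fact (d - i) * fact (d + i)) \<le> (1 / (fact d * fact d) :: real)"
    by (metis mult.right_neutral times_divide_eq_right)
  then have "fact d * fact d \<le> (fact (d - i) * fact (d + i) :: real)"
    by (simp add: divide_le_eq le_divide_eq)
  then show ?thesis by (simp add: power2_eq_square)
qed

lemma sum_inverse_squares: "1 \<le> d \<Longrightarrow> (\<Sum>i=1..d. 1 / real i ^ 2) \<le> 2 - 1 / real d"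
proof (induction d rule: dec_induct)
  case (step n)
  have "1 / real (Suc n) ^ 2 \<le> 1 / real n - 1 / real (Suc n)"
  proof -
    have "1 / real n - 1 / real (Suc n) = 1 / (real n * real (Suc n))"
      using step by (simp add: field_simps)
    moreover have "1 / real (Suc n) ^ 2 \<le> 1 / (real n * real (Suc n))"
      using step by (intro divide_left_mono) (auto simp: power2_eq_square)
    ultimately show ?thesis by simp
  qed
  then show ?case using step by simp
qed simp

text \<open>The Lagrange weight at \<open>1\<close> of the node \<open>4 i\<^sup>2\<close>, up to the factor coming from the node \<open>0\<close>.\<close>

lemma lagrange_weight_bound:
  assumes i: "i \<in> {1..d}"
  shows "\<bar>\<Prod>j\<in>{1..d} - {i}. (1 - 4 * real j ^ 2) / (4 * real i ^ 2 - 4 * real j ^ 2)\<bar> \<le> 2"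
proof -
  have "\<bar>\<Prod>j\<in>{1..d} - {i}. (1 - 4 * real j ^ 2) / (4 * real i ^ 2 - 4 * real j ^ 2)\<bar>
      = (\<Prod>j\<in>{1..d} - {i}. \<bar>(1 - 4 * real j ^ 2) / (4 * real i ^ 2 - 4 * real j ^ 2)\<bar>)"
    by (rule abs_prod)
  also have "\<dots> \<le> (\<Prod>j\<in>{1..d} - {i}. real j ^ 2 / \<bar>real j ^ 2 - real i ^ 2\<bar>)"
  proof (intro prod_mono conjI)
    fix j assume j: "j \<in> {1..d} - {i}"
    then have "1 \<le> real j ^ 2" by simp
    then have "\<bar>1 - 4 * real j ^ 2\<bar> \<le> 4 * real j ^ 2" by linarith
    then have "\<bar>1 - 4 * real j ^ 2\<bar> / (4 * \<bar>real j ^ 2 - real i ^ 2\<bar>) \<le> 4 * real j ^ 2 / (4 * \<bar>real j ^ 2 - real i ^ 2\<bar>)"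
      by (intro divide_right_mono) auto
    moreover have "4 * \<bar>real j ^ 2 - real i ^ 2\<bar> = \<bar>4 * real i ^ 2 - 4 * real j ^ 2\<bar>"
      by (simp add: abs_if)
    ultimately show "\<bar>(1 - 4 * real j ^ 2) / (4 * real i ^ 2 - 4 * real j ^ 2)\<bar> \<le> real j ^ 2 / \<bar>real j ^ 2 - real i ^ 2\<bar>"
      by (metis (no_types, lifting) abs_divide mult_divide_mult_cancel_left_if zero_neq_numeral)
  qed simp
  also have "\<dots> = (\<Prod>j\<in>{1..d} - {i}. real j ^ 2) / (\<Prod>j\<in>{1..d} - {i}. \<bar>real j ^ 2 - real i ^ 2\<bar>)"
    by (rule prod_dividef)
  \<comment> \<open>The numerator is (d!)^2 / i^2, and \<open>prod_square_diff\<close> evaluates the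
    denominator.\<close>
  also have "\<dots> = 2 * fact d ^ 2 / (fact (d - i) * fact (d + i))"
  proof -
    have "(\<Prod>j\<in>{1..d}. real j ^ 2) = real i ^ 2 * (\<Prod>j\<in>{1..d} - {i}. real j ^ 2)"
      using i by (intro prod.remove) auto
    moreover have "(\<Prod>j\<in>{1..d}. real j ^ 2) = fact d ^ 2"
      by (simp only: fact_prod of_nat_prod prod_power_distrib)
    moreover have "0 < real i ^ 2" using i by simp
    ultimately show ?thesis
      using i by (subst prod_square_diff[symmetric]) (auto simp: field_simps)
  qed
  also have "\<dots> \<le> 2"
    using fact_square_le[of i d] i by (simp add: field_simps)
  finally show ?thesis .
qed

text \<open>Interpolate at the quadratically spaced integers \<open>4 * i\<^sup>2\<close> with
  \<open>i \<le> d\<close>. If \<open>k\<close> were at least \<open>4 * d\<^sup>2\<close>, then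
  \<open>p\<close> would be between 0 and 1 at all of them. The weights at 1 of the nonzero nodes
  are at most 1 / (2 i^2) in absolute value and sum to less than 1, contradicting
  \<open>poly p 1 = 1\<close>.\<close>

lemma slow_polynomial_bound:
  fixes p :: "real poly"
  assumes deg: "degree p \<le> d" and d: "1 \<le> d"
    and p0: "poly p 0 = 0" and p1: "poly p 1 = 1"
    and bd: "\<And>t. t \<le> k \<Longrightarrow> 0 \<le> poly p (real t) \<and> poly p (real t) \<le> 1"
  shows "k < 4 * d\<^sup>2"
proof (rule ccontr)
  assume "\<not> k < 4 * d\<^sup>2"
  then have k: "4 * d\<^sup>2 \<le> k" by simp
  define n where "n i = 4 * real i ^ 2" for i :: nat
  define T where "T = n ` {0..d}"
  have inj: "inj n" unfolding n_def by (auto simp: inj_on_def)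
  have cT: "card T = Suc d" unfolding T_def using inj by (simp add: card_image inj_on_subset)
  have T: "T - {n i} = n ` ({0..d} - {i})" for i
    unfolding T_def using inj by (auto simp: inj_on_def)
  have n0: "n 0 = 0" by (simp add: n_def)
  have "1 = (\<Sum>t\<in>T. poly p t * (\<Prod>s\<in>T - {t}. (1 - s) / (t - s)))"
    using lagrange_interpolation[of T p 1] p1 deg cT by (simp add: T_def)
  also have "\<dots> = (\<Sum>i\<in>{0..d}. poly p (n i) * (\<Prod>j\<in>{0..d} - {i}. (1 - n j) / (n i - n j)))"
    unfolding T_def using inj
    by (simp add: sum.reindex inj_on_subset T[unfolded T_def] prod.reindex)
  also have "\<dots> = (\<Sum>i\<in>{1..d}. poly p (n i) * (\<Prod>j\<in>{0..d} - {i}. (1 - n j) / (n i - n j)))"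
    using p0 by (intro sum.mono_neutral_right) (auto simp: n0 not_le)
  also have "\<dots> \<le> (\<Sum>i\<in>{1..d}. 1 / (2 * real i ^ 2))"
  proof (intro sum_mono)
    fix i assume i: "i \<in> {1..d}"
    let ?L = "\<Prod>j\<in>{0..d} - {i}. (1 - n j) / (n i - n j)"
    have "{0..d} - {i} = insert 0 ({1..d} - {i})" using i by auto
    then have "?L = 1 / n i * (\<Prod>j\<in>{1..d} - {i}. (1 - n j) / (n i - n j))"
      by (simp add: n0)
    then have "\<bar>?L\<bar> = 1 / n i * \<bar>\<Prod>j\<in>{1..d} - {i}. (1 - n j) / (n i - n j)\<bar>"
      by (simp add: abs_mult n_def)
    also have "\<dots> \<le> 1 / n i * 2"
      using lagrange_weight_bound[OF i] by (intro mult_left_mono) (auto simp: n_def)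
    also have "\<dots> = 1 / (2 * real i ^ 2)" by (simp add: n_def)
    finally have L: "\<bar>?L\<bar> \<le> 1 / (2 * real i ^ 2)" .
    have "4 * i\<^sup>2 \<le> k" using i k power_mono[of i d 2] by (meson atLeastAtMost_iff le_trans mult_le_mono2 zero_le)
    from bd[OF this] have "0 \<le> poly p (n i)" "poly p (n i) \<le> 1" by (auto simp: n_def)
    then have "poly p (n i) * ?L \<le> 1 * \<bar>?L\<bar>"
      by (meson abs_ge_self abs_ge_zero mult_left_mono mult_right_mono order.trans)
    then show "poly p (n i) * ?L \<le> 1 / (2 * real i ^ 2)" using L by simp
  qed
  also have "\<dots> = (\<Sum>i=1..d. 1 / real i ^ 2) / 2"
    by (simp add: sum_divide_distrib mult.commute)
  also have "\<dots> < 1"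
  proof -
    have "0 < 1 / real d" using d by simp
    then show ?thesis using sum_inverse_squares[OF d] by linarith
  qed
  finally show False by simp
qed

section \<open>Symmetrization and the quadratic sensitivity bound\<close>

lemma card_supersets_of_size:
  assumes "finite V" "S \<subseteq> V" "card S \<le> t"
  shows "card {x. S \<subseteq> x \<and> x \<subseteq> V \<and> card x = t} = (card V - card S) choose (t - card S)"
proof -
  have fS: "finite S" using assms finite_subset by blast
  have "bij_betw (\<lambda>y. S \<union> y) {y. y \<subseteq> V - S \<and> card y = t - card S} {x. S \<subseteq> x \<and> x \<subseteq> V \<and> card x = t}"
  proof (rule bij_betw_byWitness[where f' = "\<lambda>x. x - S"])
    show "(\<lambda>y. S \<union> y) ` {y. y \<subseteq> V - S \<and> card y = t - card S} \<subseteq> {x. S \<subseteq> x \<and> x \<subseteq> V \<and> card x = t}"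
    proof clarify
      fix y assume y: "y \<subseteq> V - S" "card y = t - card S"
      then have "finite y" using assms finite_subset by blast
      then have "card (S \<union> y) = card S + card y" using y fS by (intro card_Un_disjoint) auto
      then show "S \<subseteq> S \<union> y \<and> S \<union> y \<subseteq> V \<and> card (S \<union> y) = t" using y assms by auto
    qed
    show "(\<lambda>x. x - S) ` {x. S \<subseteq> x \<and> x \<subseteq> V \<and> card x = t} \<subseteq> {y. y \<subseteq> V - S \<and> card y = t - card S}"
      using fS by (auto simp: card_Diff_subset)
  qed auto
  then have "card {x. S \<subseteq> x \<and> x \<subseteq> V \<and> card x = t} = card {y. y \<subseteq> V - S \<and> card y = t - card S}"
    by (rule bij_betw_same_card[symmetric])
  also have "\<dots> = card (V - S) choose (t - card S)"
    using assms by (intro n_subsets) auto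
  finally show ?thesis using fS assms by (simp add: card_Diff_subset)
qed

lemma binomial_poly: "\<exists>p. degree p \<le> s \<and> (\<forall>t. poly p (real t) = real (t choose s))"
proof (intro exI conjI allI)
  let ?p = "smult (1 / fact s) (\<Prod>j<s. [:- real j, 1:])"
  have "degree (\<Prod>j<s. [:- real j, 1:]) \<le> (\<Sum>j<s. degree [:- real j, 1:])"
    using degree_prod_sum_le[of "{..<s}" "\<lambda>j. [:- real j, 1:]"] by (simp add: o_def)
  then show "degree ?p \<le> s" by simp
  show "poly ?p (real t) = real (t choose s)" for t
    by (simp add: poly_prod binomial_gbinomial gbinomial_prod_rev atLeast0LessThan)
qed

text \<open>The average of a monomial of size s over the sets of size t is (t choose s) / (card V
  choose s), a polynomial in t of degree s. Clearing the number of sets from the average keeps the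
  statement free of division.\<close>

lemma symmetrization:
  assumes "finite V" "deg_le d g"
  shows "\<exists>p. degree p \<le> d \<and> (\<forall>t \<le> card V.
    (\<Sum>x | x \<subseteq> V \<and> card x = t. g x) = real (card V choose t) * poly p (real t))"
  using assms(2)
proof (induction rule: deg_le.induct)
  case (monom S c)
  show ?case
  proof (cases "S \<subseteq> V")
    case True
    obtain b where b: "degree b \<le> card S" "\<And>t. poly b (real t) = real (t choose card S)"
      using binomial_poly by blast
    have cS: "card S \<le> card V" using True assms(1) by (simp add: card_mono)
    let ?p = "smult (c / real (card V choose card S)) b"
    have "(\<Sum>x | x \<subseteq> V \<and> card x = t. c * of_bool (S \<subseteq> x)) = real (card V choose t) * poly ?p (real t)"
      if t: "t \<le> card V" for t
    proof -
      have "(\<Sum>x | x \<subseteq> V \<and> card x = t. c * of_bool (S \<subseteq> x))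
          = (\<Sum>x | S \<subseteq> x \<and> x \<subseteq> V \<and> card x = t. c)"
        using assms(1) by (intro sum.mono_neutral_cong_right) auto
      also have "\<dots> = c * real (card {x. S \<subseteq> x \<and> x \<subseteq> V \<and> card x = t})" by simp
      also have "\<dots> = real (card V choose t) * poly ?p (real t)"
      proof (cases "card S \<le> t")
        case False
        have "card S \<le> card x" if "S \<subseteq> x" "x \<subseteq> V" for x
          using that assms(1) by (meson card_mono finite_subset)
        then have "{x. S \<subseteq> x \<and> x \<subseteq> V \<and> card x = t} = {}" using False by blast
        moreover have "t choose card S = 0" using False by (simp add: binomial_eq_0)
        ultimately show ?thesis using b(2)[of t] by (simp only: poly_smult card.empty)
      next
        case le: True
        have "(card V choose t) * (t choose card S) = (card V choose card S) * ((card V - card S) choose (t - card S))"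
          using le t by (rule choose_mult)
        then have "real (card V choose t) * real (t choose card S)
            = real (card V choose card S) * real ((card V - card S) choose (t - card S))"
          by (metis of_nat_mult)
        moreover have "real (card V choose card S) > 0" using cS by simp
        ultimately have "real ((card V - card S) choose (t - card S))
            = real (card V choose t) * real (t choose card S) / real (card V choose card S)"
          by (simp add: eq_divide_eq mult.commute)
        then show ?thesis
          unfolding card_supersets_of_size[OF assms(1) True le] poly_smult b(2) by (simp only:) simp
      qed
      finally show ?thesis .
    qed
    moreover have "degree ?p \<le> d" using b monom by (meson degree_smult_le order.trans)
    ultimately show ?thesis by blast
  next
    case False
    then have "(\<Sum>x | x \<subseteq> V \<and> card x = t. c * of_bool (S \<subseteq> x)) = 0" for t
      by (intro sum.neutral) auto
    then show ?thesis by (intro exI[of _ 0]) auto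
  qed
next
  case (add f g)
  then obtain p q where deg: "degree p \<le> d" "degree q \<le> d"
    and p: "\<And>t. t \<le> card V \<Longrightarrow> (\<Sum>x | x \<subseteq> V \<and> card x = t. f x) = real (card V choose t) * poly p (real t)"
    and q: "\<And>t. t \<le> card V \<Longrightarrow> (\<Sum>x | x \<subseteq> V \<and> card x = t. g x) = real (card V choose t) * poly q (real t)"
    by blast
  have "degree (p + q) \<le> d" using deg by (rule degree_add_le)
  moreover have "(\<Sum>x | x \<subseteq> V \<and> card x = t. f x + g x) = real (card V choose t) * poly (p + q) (real t)"
    if "t \<le> card V" for t
    using p[OF that] q[OF that] by (simp only: sum.distrib poly_add distrib_left)
  ultimately show ?case by (intro exI[of _ "p + q"] conjI allI impI)
qed

text \<open>The symmetrized polynomial is 0 at 0, is 1 at 1, and stays between 0 and 1 at the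
  integers up to \<open>card V\<close>, so \<open>slow_polynomial_bound\<close> applies with
  \<open>k = card V\<close>.\<close>

lemma sensitivity_weak_bound:
  assumes "finite V" "bool_on V g" "deg_le d g" "1 \<le> d"
    and g0: "g {} = 0" and g1: "\<And>i. i \<in> V \<Longrightarrow> g {i} = 1"
  shows "card V < 4 * d\<^sup>2"
proof (cases "V = {}")
  case True
  then show ?thesis using assms by simp
next
  case False
  then have V: "1 \<le> card V" using assms(1) by (simp add: Suc_le_eq card_gt_0_iff)
  obtain p where p: "degree p \<le> d" "\<And>t. t \<le> card V \<Longrightarrow>
      (\<Sum>x | x \<subseteq> V \<and> card x = t. g x) = real (card V choose t) * poly p (real t)"
    using symmetrization[OF assms(1,3)] by blast
  have "{x. x \<subseteq> V \<and> card x = 0} = {{}}"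
    using assms(1) finite_subset by (auto simp: card_eq_0_iff)
  then have p0: "poly p 0 = 0" using p(2)[of 0] g0 by simp
  have "{x. x \<subseteq> V \<and> card x = 1} = (\<lambda>i. {i}) ` V"
    by (auto simp: card_1_singleton_iff)
  then have "(\<Sum>x | x \<subseteq> V \<and> card x = 1. g x) = real (card V)"
    using g1 by (simp add: sum.reindex)
  then have p1: "poly p 1 = 1" using p(2)[of 1] V by simp
  have "0 \<le> poly p (real t) \<and> poly p (real t) \<le> 1" if t: "t \<le> card V" for t
  proof -
    have B: "0 \<le> g x \<and> g x \<le> 1" if "x \<subseteq> V" for x
    proof -
      have "g x \<in> {0, 1}" using assms(2) that unfolding bool_on_def by blast
      then show ?thesis by auto
    qed
    have pos: "real (card V choose t) > 0" using t by simp
    have "0 \<le> (\<Sum>x | x \<subseteq> V \<and> card x = t. g x)"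
      using B by (intro sum_nonneg) auto
    moreover have "(\<Sum>x | x \<subseteq> V \<and> card x = t. g x) \<le> (\<Sum>x | x \<subseteq> V \<and> card x = t. 1)"
      using B by (intro sum_mono) auto
    moreover have "(\<Sum>x | x \<subseteq> V \<and> card x = t. 1) = real (card V choose t)"
      using n_subsets[OF assms(1)] by simp
    ultimately show ?thesis
      using p(2)[OF t] pos by (simp add: zero_le_mult_iff)
  qed
  then show ?thesis
    using slow_polynomial_bound[OF p(1) assms(4) p0 p1] by blast
qed

text \<open>The m-fold composition of \<open>g\<close> with itself. Its variables are the
  root-to-leaf paths of the composition tree, that is, lists of length \<open>m\<close> over
  \<open>V\<close>; \<open>{l. i # l \<in> x}\<close> is the input of the subtree below
  \<open>i\<close>.\<close>

primrec tower :: "'a set \<Rightarrow> ('a set \<Rightarrow> real) \<Rightarrow> nat \<Rightarrow> 'a list set \<Rightarrow> real" where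
  "tower V g 0 x = of_bool ([] \<in> x)"
| "tower V g (Suc m) x = g {i \<in> V. tower V g m {l. i # l \<in> x} = 1}"

lemma tower_bool:
  assumes "bool_on V g"
  shows "tower V g m x \<in> {0, 1}"
  using assms by (cases m) (auto simp: bool_on_def)

lemma tower_deg:
  assumes "deg_le d g" "bool_on V g"
  shows "deg_le (d ^ m) (tower V g m)"
proof (induction m)
  case 0
  have "tower V g 0 = (\<lambda>x. of_bool ([] \<in> x))" by auto
  then show ?case by (simp add: deg_le_var)
next
  case (Suc m)
  have "deg_le (d ^ m) (\<lambda>x. tower V g m {l. i # l \<in> x})" for i
  proof -
    \<comment> \<open>Renaming variables is a substitution of degree 1.\<close>
    have "deg_le (d ^ m * 1) (\<lambda>x. tower V g m {l \<in> UNIV. of_bool (i # l \<in> x) = (1::real)})"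
      by (rule deg_le_subst[OF Suc]) (auto intro: deg_le_var)
    then show ?thesis by simp
  qed
  then have "deg_le (d * d ^ m) (\<lambda>x. g {i \<in> V. tower V g m {l. i # l \<in> x} = 1})"
    using tower_bool[OF assms(2)] by (intro deg_le_subst assms) auto
  moreover have "tower V g (Suc m) = (\<lambda>x. g {i \<in> V. tower V g m {l. i # l \<in> x} = 1})" by auto
  ultimately show ?case by simp
qed

lemma tower_empty: "g {} = 0 \<Longrightarrow> tower V g m {} = 0"
  by (induction m) auto

text \<open>Only the subtree on the path \<open>l\<close> receives a nonempty input and all others
  evaluate to 0, so \<open>g\<close> is evaluated at a singleton on every level.\<close>

lemma tower_singleton:
  assumes "g {} = 0" "\<And>i. i \<in> V \<Longrightarrow> g {i} = 1"
  shows "set l \<subseteq> V \<Longrightarrow> tower V g (length l) {l} = 1"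
proof (induction l)
  case (Cons a l)
  have "{i \<in> V. tower V g (length l) {l'. i # l' \<in> {a # l}} = 1} = {a}"
  proof -
    have "{l'. i # l' \<in> {a # l}} = (if i = a then {l} else {})" for i by auto
    then show ?thesis using Cons tower_empty[of g V, OF assms(1)] by auto
  qed
  then show ?case using assms Cons by simp
qed simp

text \<open>Iterated composition multiplies both sensitivity and degree, so the constant \<open>4\<close>
  of the weak bound is amplified away.\<close>

lemma sensitivity_bound:
  assumes "finite V" "bool_on V g" "deg_le d g" "1 \<le> d"
    and g0: "g {} = 0" and g1: "\<And>i. i \<in> V \<Longrightarrow> g {i} = 1"
  shows "card V \<le> d\<^sup>2"
proof (rule ccontr)
  assume "\<not> card V \<le> d\<^sup>2"
  then have "1 < real (card V) / real (d\<^sup>2)" using assms(4) by (simp del: of_nat_power)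
  \<comment> \<open>The \<open>m\<close>-fold tower has \<open>card V ^ m\<close> sensitive
    variables and degree at most \<open>d ^ m\<close>. This \<open>m\<close> makes their ratio
    violate the weak bound with its constant 4.\<close>
  then obtain m where m: "4 < (real (card V) / real (d\<^sup>2)) ^ m" using real_arch_pow by blast
  let ?L = "{l. set l \<subseteq> V \<and> length l = m}"
  have "card ?L < 4 * (d ^ m)\<^sup>2"
  proof (rule sensitivity_weak_bound)
    show "finite ?L" using assms(1) by (rule finite_lists_length_eq)
    show "bool_on ?L (tower V g m)" using tower_bool[OF assms(2)] by (auto simp: bool_on_def)
    show "deg_le (d ^ m) (tower V g m)" using tower_deg assms by blast
    show "tower V g m {} = 0" using tower_empty g0 by blast
    show "tower V g m {l} = 1" if "l \<in> ?L" for l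
      using tower_singleton[of g V l, OF g0 g1] that by auto
  qed (use assms in auto)
  then have "card V ^ m < 4 * (d\<^sup>2) ^ m"
    using card_lists_length_eq[OF assms(1), of m] by (simp add: power_commutes flip: power_mult) (simp add: mult.commute)
  then have "real (card V ^ m) < real (4 * (d\<^sup>2) ^ m)" by linarith
  then have "(real (card V) / real (d\<^sup>2)) ^ m < 4"
    using assms(4) by (simp add: power_divide field_simps)
  then show False using m by simp
qed

lemma mcoeff_insert_diff:
  assumes "finite S" "h \<notin> S"
  shows "mcoeff (\<lambda>x. f (insert h x)) S = mcoeff f S + mcoeff f (insert h S)"
  using mcoeff_insert[OF assms, of f] by simp

section \<open>Influence and weights\<close>

text \<open>In Fourier terms the left side weighs the squared coefficient of each S by 4 times
  \<open>card S\<close>, and \<open>card S \<le> d\<close>. The proof inducts over the variables: on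
  the two halves of the cube \<open>f\<close> equals \<open>a - b\<close> and \<open>a + b\<close>,
  and the parallelogram law separates the contributions of \<open>a\<close> and
  \<open>b\<close>.\<close>

lemma total_influence_bound:
  assumes "finite V" "deg_on V d f"
  shows "(\<Sum>x\<in>Pow V. \<Sum>i\<in>V. (f (insert i x) - f (x - {i}))\<^sup>2) \<le> 4 * real d * (\<Sum>x\<in>Pow V. (f x)\<^sup>2)"
  using assms
proof (induction V arbitrary: d f rule: finite_induct)
  case (insert h V)
  define I where "I f = (\<Sum>x\<in>Pow V. \<Sum>i\<in>V. (f (insert i x) - f (x - {i}))\<^sup>2)" for f :: "'a set \<Rightarrow> real"
  define Q where "Q f = (\<Sum>x\<in>Pow V. (f x)\<^sup>2)" for f :: "'a set \<Rightarrow> real"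
  define f1 where "f1 x = f (insert h x)" for x
  define a where "a x = 1/2 * f x + 1/2 * f1 x" for x
  define b where "b x = (-1/2) * f x + 1/2 * f1 x" for x
  have mb: "mcoeff b S = 1/2 * mcoeff f (insert h S)" if "S \<subseteq> V" for S
  proof -
    have "finite S" "h \<notin> S" using that insert.hyps finite_subset by auto
    then show ?thesis unfolding b_def mcoeff_linear
      unfolding f1_def by (simp add: mcoeff_insert)
  qed
  have da: "deg_on V d a" unfolding deg_on_def
  proof (intro allI impI)
    fix S assume S: "S \<subseteq> V" "mcoeff a S \<noteq> 0"
    then have fS: "finite S" "h \<notin> S" using insert.hyps finite_subset by auto
    then have "mcoeff f S \<noteq> 0 \<or> mcoeff f (insert h S) \<noteq> 0"
      using S mcoeff_insert_diff[of S h f] unfolding a_def mcoeff_linear f1_def by auto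
    then show "card S \<le> d"
    proof
      assume "mcoeff f S \<noteq> 0"
      then show ?thesis using insert.prems S unfolding deg_on_def by blast
    next
      assume "mcoeff f (insert h S) \<noteq> 0"
      then have "card (insert h S) \<le> d" using insert.prems S unfolding deg_on_def by blast
      then show ?thesis using fS by simp
    qed
  qed
  \<comment> \<open>The half-difference \<open>b\<close> has degree at most d - 1, and the saved
    \<open>4 * Q b\<close> pays for direction \<open>h\<close>. For \<open>d = 0\<close> there is no
    smaller degree, but then \<open>b\<close> vanishes.\<close>
  have db: "I b + 4 * Q b \<le> 4 * real d * Q b"
  proof (cases d)
    case 0
    have "b x = 0" if "x \<subseteq> V" for x
    proof (rule mcoeff_all_zero[OF insert.hyps(1) _ that])
      fix S assume S: "S \<subseteq> V"
      then have "finite (insert h S)" using insert.hyps finite_subset by auto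
      then have "\<not> card (insert h S) \<le> d" using 0 by auto
      then have "mcoeff f (insert h S) = 0" using insert.prems S unfolding deg_on_def by blast
      then show "mcoeff b S = 0" by (simp add: mb[OF S])
    qed
    moreover have "insert i x \<subseteq> V" "x - {i} \<subseteq> V" if "x \<subseteq> V" "i \<in> V" for x i using that by auto
    ultimately have "I b = 0" "Q b = 0" unfolding I_def Q_def
      by (auto intro!: sum.neutral)
    then show ?thesis by simp
  next
    case (Suc e)
    have "deg_on V e b" unfolding deg_on_def
    proof (intro allI impI)
      fix S assume S: "S \<subseteq> V" "mcoeff b S \<noteq> 0"
      then have "mcoeff f (insert h S) \<noteq> 0" using mb by auto
      then have "card (insert h S) \<le> d" using insert.prems S unfolding deg_on_def by blast
      moreover have "finite S" "h \<notin> S" using S insert.hyps finite_subset by auto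
      ultimately show "card S \<le> e" using Suc by simp
    qed
    then have "I b \<le> 4 * real e * Q b" using insert.IH unfolding I_def Q_def by blast
    then show ?thesis using Suc by (simp add: algebra_simps)
  qed
  have sq: "(p + q)\<^sup>2 + (p - q)\<^sup>2 = 2 * (p\<^sup>2 + q\<^sup>2)" for p q :: real
    by (simp add: power2_eq_square algebra_simps)
  have f_ab: "f x = a x - b x" "f1 x = a x + b x" for x
    by (auto simp: a_def b_def)
  have Q: "(\<Sum>x\<in>Pow (insert h V). (f x)\<^sup>2) = 2 * (Q a + Q b)"
  proof -
    have "(\<Sum>x\<in>Pow (insert h V). (f x)\<^sup>2) = (\<Sum>x\<in>Pow V. (f x)\<^sup>2 + (f1 x)\<^sup>2)"
      unfolding sum_Pow_insert[OF insert.hyps] f1_def ..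
    also have "\<dots> = (\<Sum>x\<in>Pow V. 2 * ((a x)\<^sup>2 + (b x)\<^sup>2))"
      unfolding f_ab using sq by (simp add: add.commute)
    finally show ?thesis unfolding Q_def by (simp add: sum.distrib sum_distrib_left)
  qed
  have I: "(\<Sum>x\<in>Pow (insert h V). \<Sum>i\<in>insert h V. (f (insert i x) - f (x - {i}))\<^sup>2)
      = 2 * (I a + I b) + 8 * Q b"
  proof -
    let ?D = "\<lambda>g x i. g (insert i x) - g (x - {i})"
    have "(\<Sum>i\<in>insert h V. (?D f x i)\<^sup>2) + (\<Sum>i\<in>insert h V. (?D f (insert h x) i)\<^sup>2)
        = 8 * (b x)\<^sup>2 + (\<Sum>i\<in>V. 2 * ((?D a x i)\<^sup>2 + (?D b x i)\<^sup>2))" if x: "x \<in> Pow V" for x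
    proof -
      have hx: "h \<notin> x" using x insert.hyps by auto
      then have "x - {h} = x" "insert h x - {h} = x" by auto
      moreover have "f (insert h x) - f x = 2 * b x" using f_ab[of x] by (simp add: f1_def)
      ultimately have h: "(?D f x h)\<^sup>2 + (?D f (insert h x) h)\<^sup>2 = 8 * (b x)\<^sup>2"
        by (simp add: power_mult_distrib)
      have "(?D f x i)\<^sup>2 + (?D f (insert h x) i)\<^sup>2 = 2 * ((?D a x i)\<^sup>2 + (?D b x i)\<^sup>2)" if i: "i \<in> V" for i
      proof -
        have "insert h x - {i} = insert h (x - {i})" "insert i (insert h x) = insert h (insert i x)"
          using i insert.hyps by auto
        then have "?D f (insert h x) i = ?D f1 x i" by (simp add: f1_def)
        moreover have "?D f1 x i = ?D a x i + ?D b x i" "?D f x i = ?D a x i - ?D b x i"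
          by (auto simp: f_ab)
        ultimately show ?thesis using sq[of "?D a x i" "?D b x i"] by (simp add: add.commute)
      qed
      then have "(\<Sum>i\<in>V. (?D f x i)\<^sup>2 + (?D f (insert h x) i)\<^sup>2) = (\<Sum>i\<in>V. 2 * ((?D a x i)\<^sup>2 + (?D b x i)\<^sup>2))"
        by (rule sum.cong[OF refl])
      then show ?thesis using h insert.hyps by (simp add: sum.distrib)
    qed
    then have "(\<Sum>x\<in>Pow (insert h V). \<Sum>i\<in>insert h V. (?D f x i)\<^sup>2)
        = (\<Sum>x\<in>Pow V. 8 * (b x)\<^sup>2 + (\<Sum>i\<in>V. 2 * ((?D a x i)\<^sup>2 + (?D b x i)\<^sup>2)))"
      unfolding sum_Pow_insert[OF insert.hyps] by (rule sum.cong[OF refl])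
    then show ?thesis unfolding I_def Q_def by (simp add: sum.distrib flip: sum_distrib_left)
  qed
  have "I a \<le> 4 * real d * Q a" using insert.IH[OF da] unfolding I_def Q_def .
  then show ?case unfolding I Q using db by (simp add: algebra_simps)
qed simp

text \<open>Schwartz-Zippel on the cube: a nonzero polynomial of degree \<open>d\<close> is nonzero
  on at least a fraction 1 / 2^d of the points. If both halves are nonzero, each contributes its
  share. Otherwise \<open>f\<close> is the surviving half times the variable \<open>h\<close> or its
  negation, and that half has smaller degree.\<close>

lemma card_nonzero_ge:
  assumes "finite V" "deg_on V d f" "S \<subseteq> V" "mcoeff f S \<noteq> 0"
  shows "2 ^ card V \<le> 2 ^ d * card {x. x \<subseteq> V \<and> f x \<noteq> 0}"
  using assms
proof (induction V arbitrary: d f S rule: finite_induct)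
  case empty
  then have "{x. x \<subseteq> {} \<and> f x \<noteq> 0} = {{}}" by auto
  then show ?case by simp
next
  case (insert h V)
  define f1 where "f1 x = f (insert h x)" for x
  let ?N = "\<lambda>f. card {x. x \<subseteq> V \<and> f x \<noteq> 0}"
  have m1: "mcoeff f1 T = mcoeff f T + mcoeff f (insert h T)" if "T \<subseteq> V" for T
    unfolding f1_def using that insert.hyps finite_subset by (intro mcoeff_insert_diff) auto
  have degh: "card T < d" if "T \<subseteq> V" "mcoeff f (insert h T) \<noteq> 0" for T
  proof -
    have "insert h T \<subseteq> insert h V" using that by auto
    then have "card (insert h T) \<le> d" using insert.prems(1) that unfolding deg_on_def by blast
    moreover have "finite T" "h \<notin> T" using that insert.hyps finite_subset by auto
    ultimately show ?thesis by simp
  qed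
  have degf: "card T \<le> d" if "T \<subseteq> V" "mcoeff f T \<noteq> 0" for T
    using insert.prems(1) that unfolding deg_on_def by blast
  have inj: "inj_on (insert h) {x. x \<subseteq> V \<and> f1 x \<noteq> 0}"
    using insert.hyps by (auto simp: inj_on_def)
  have "{x. x \<subseteq> insert h V \<and> f x \<noteq> 0} = {x. x \<subseteq> V \<and> f x \<noteq> 0} \<union> insert h ` {x. x \<subseteq> V \<and> f1 x \<noteq> 0}"
    (is "?A = ?B \<union> ?C")
  proof (intro subset_antisym subsetI)
    fix x assume x: "x \<in> ?A"
    show "x \<in> ?B \<union> ?C"
    proof (cases "h \<in> x")
      case True
      then have "x = insert h (x - {h})" by auto
      then have "x \<in> ?C" using x by (intro image_eqI[of x _ "x - {h}"]) (auto simp: f1_def insert_absorb)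
      then show ?thesis ..
    qed (use x in auto)
  qed (auto simp: f1_def)
  then have N: "card {x. x \<subseteq> insert h V \<and> f x \<noteq> 0} = ?N f + ?N f1"
  proof -
    have "?B \<inter> ?C = {}" "finite ?B" "finite ?C" using insert.hyps by auto
    then have "card (?B \<union> ?C) = card ?B + card ?C" by (intro card_Un_disjoint)
    moreover have "card ?C = ?N f1" using inj by (rule card_image)
    ultimately show ?thesis using \<open>?A = ?B \<union> ?C\<close> by (simp only:)
  qed
  have cV: "2 ^ card (insert h V) = (2 :: nat) * 2 ^ card V" using insert.hyps by simp
  consider (both) T U where "T \<subseteq> V" "mcoeff f T \<noteq> 0" "U \<subseteq> V" "mcoeff f1 U \<noteq> 0"
    | (zero) "\<And>T. T \<subseteq> V \<Longrightarrow> mcoeff f T = 0"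
    | (one) "\<And>T. T \<subseteq> V \<Longrightarrow> mcoeff f1 T = 0"
    by blast
  then show ?case
  proof cases
    case both
    have "card T \<le> d" if "T \<subseteq> V" "mcoeff f1 T \<noteq> 0" for T
      using m1[of T] degh[of T] degf[of T] that by (cases "mcoeff f T = 0") auto
    then have "deg_on V d f1" unfolding deg_on_def by blast
    then have "2 ^ card V \<le> 2 ^ d * ?N f1" using insert.IH both by blast
    moreover have "2 ^ card V \<le> 2 ^ d * ?N f"
      using insert.IH[of d f T] both degf unfolding deg_on_def by blast
    ultimately show ?thesis unfolding N cV distrib_left by linarith
  next
    case zero
    then have m: "mcoeff f1 T = mcoeff f (insert h T)" if "T \<subseteq> V" for T using m1 that by simp
    have "\<not> S \<subseteq> V" using zero insert.prems by auto
    then have "h \<in> S" and SV: "S - {h} \<subseteq> V" using insert.prems(2) by auto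
    then have "insert h (S - {h}) = S" by auto
    then have S: "S - {h} \<subseteq> V" "mcoeff f1 (S - {h}) \<noteq> 0"
      using insert.prems(3) m[OF SV] SV by auto
    then obtain e where e: "d = Suc e" using degh[of "S - {h}"] m[of "S - {h}"] by (cases d) auto
    have "card T \<le> e" if "T \<subseteq> V" "mcoeff f1 T \<noteq> 0" for T
      using degh[of T] m[of T] that e by auto
    then have "deg_on V e f1" unfolding deg_on_def by blast
    then have "2 ^ card V \<le> 2 ^ e * ?N f1" using insert.IH S by blast
    also have "\<dots> \<le> 2 ^ e * (?N f + ?N f1)" by (intro mult_le_mono2) simp
    finally show ?thesis unfolding N cV e by simp
  next
    case one
    then have m: "mcoeff f (insert h T) = - mcoeff f T" if "T \<subseteq> V" for T using m1 that by (simp add: eq_neg_iff_add_eq_0 add.commute)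
    have S: "S - {h} \<subseteq> V" "mcoeff f (S - {h}) \<noteq> 0"
    proof -
      show "S - {h} \<subseteq> V" using insert.prems by auto
      then show "mcoeff f (S - {h}) \<noteq> 0"
        using m[of "S - {h}"] insert.prems by (cases "h \<in> S") (auto simp: insert_absorb)
    qed
    then obtain e where e: "d = Suc e" using degh[of "S - {h}"] m[of "S - {h}"] by (cases d) auto
    have "card T \<le> e" if "T \<subseteq> V" "mcoeff f T \<noteq> 0" for T
      using degh[of T] m[of T] that e by auto
    then have "deg_on V e f" unfolding deg_on_def by blast
    then have "2 ^ card V \<le> 2 ^ e * ?N f" using insert.IH S by blast
    also have "\<dots> \<le> 2 ^ e * (?N f + ?N f1)" by (intro mult_le_mono2) simp
    finally show ?thesis unfolding N cV e by simp
  qed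
qed

section \<open>Weights of variables under restriction\<close>

definition occ_sizes :: "'a set \<Rightarrow> ('a set \<Rightarrow> real) \<Rightarrow> 'a \<Rightarrow> nat set" where
  "occ_sizes V f i = {card S | S. S \<subseteq> V \<and> i \<in> S \<and> mcoeff f S \<noteq> 0}"

text \<open>The value 0 for a variable in no monomial keeps \<open>Max\<close> away from the empty
  set and lets sums range over all of \<open>V\<close>.\<close>

definition weight :: "'a set \<Rightarrow> ('a set \<Rightarrow> real) \<Rightarrow> 'a \<Rightarrow> real" where
  "weight V f i = (if occ_sizes V f i = {} then 0 else (1/2) ^ Max (occ_sizes V f i))"

lemma finite_occ_sizes: "finite V \<Longrightarrow> finite (occ_sizes V f i)"
  unfolding occ_sizes_def by (rule finite_surj[of "Pow V" _ card]) auto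

lemma weight_le:
  assumes "finite V" "S \<subseteq> V" "i \<in> S" "mcoeff f S \<noteq> 0" "k \<le> card S"
  shows "weight V f i \<le> (1/2) ^ k"
proof -
  have "card S \<in> occ_sizes V f i" using assms unfolding occ_sizes_def by blast
  then have "occ_sizes V f i \<noteq> {}" "card S \<le> Max (occ_sizes V f i)"
    using finite_occ_sizes[OF assms(1)] by auto
  then show ?thesis unfolding weight_def using assms(5)
    by (auto intro!: power_decreasing)
qed

lemma weight_cases:
  assumes "finite V"
  obtains (zero) "weight V f i = 0" "\<And>S. S \<subseteq> V \<Longrightarrow> i \<in> S \<Longrightarrow> mcoeff f S = 0"
  | (pos) S where "S \<subseteq> V" "i \<in> S" "mcoeff f S \<noteq> 0" "weight V f i = (1/2) ^ card S"
      "\<And>T. T \<subseteq> V \<Longrightarrow> i \<in> T \<Longrightarrow> mcoeff f T \<noteq> 0 \<Longrightarrow> card T \<le> card S"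
proof (cases "occ_sizes V f i = {}")
  case True
  then show ?thesis using that(1) unfolding weight_def occ_sizes_def by fastforce
next
  case False
  define m where "m = Max (occ_sizes V f i)"
  have "m \<in> occ_sizes V f i"
    unfolding m_def using finite_occ_sizes[OF assms] False by (rule Max_in)
  then obtain S where S: "S \<subseteq> V" "i \<in> S" "mcoeff f S \<noteq> 0" and m: "card S = m"
    unfolding occ_sizes_def by blast
  show ?thesis
  proof (rule that(2)[OF S])
    show "weight V f i = (1/2) ^ card S"
      unfolding weight_def m m_def using False by simp
    fix T assume "T \<subseteq> V" "i \<in> T" "mcoeff f T \<noteq> 0"
    then have "card T \<in> occ_sizes V f i" unfolding occ_sizes_def by blast
    then show "card T \<le> card S"
      unfolding m m_def using finite_occ_sizes[OF assms] by (intro Max_ge)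
  qed
qed

lemma weight_nonneg: "0 \<le> weight V f i"
  by (simp add: weight_def)

text \<open>Compare the largest monomials containing \<open>i\<close> in the two restrictions. If
  they have equal size and the one from \<open>h = 0\<close> survives at \<open>h = 1\<close>, it
  bounds the weight by both restricted weights. In the other cases where \<open>i\<close> occurs,
  adding \<open>h\<close> to one of them gives a monomial of \<open>f\<close>, so the weight is at
  most half of one restricted weight.\<close>

lemma weight_restrict:
  assumes V: "finite V" "h \<notin> V" and i: "i \<in> V"
  shows "weight (insert h V) f i \<le> (weight V f i + weight V (\<lambda>x. f (insert h x)) i) / 2"
proof -
  define f1 where "f1 x = f (insert h x)" for x
  have fV: "finite (insert h V)" using V by simp
  have m1: "mcoeff f1 T = mcoeff f T + mcoeff f (insert h T)" if "T \<subseteq> V" for T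
    unfolding f1_def using that V finite_subset by (intro mcoeff_insert_diff) auto
  have le0: "weight (insert h V) f i \<le> (1/2) ^ card S" if "S \<subseteq> V" "i \<in> S" "mcoeff f S \<noteq> 0" for S
    using weight_le[OF fV, of S i f "card S"] that by blast
  have le1: "weight (insert h V) f i \<le> (1/2) ^ card S / 2" if "S \<subseteq> V" "i \<in> S" "mcoeff f (insert h S) \<noteq> 0" for S
  proof -
    have "card (insert h S) = Suc (card S)"
      using that V finite_subset by (metis card_insert_disjoint subsetD)
    then show ?thesis using weight_le[OF fV, of "insert h S" i f "Suc (card S)"] that by auto
  qed
  have nn: "0 \<le> weight V f i" "0 \<le> weight V f1 i" by (simp_all add: weight_nonneg)
  have "weight (insert h V) f i \<le> (weight V f i + weight V f1 i) / 2"
  using V(1)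
  proof (cases rule: weight_cases[where f = f and i = i])
    case zero0: zero
    show ?thesis
    using V(1)
  proof (cases rule: weight_cases[where f = f1 and i = i])
      case zero
      have "mcoeff f S = 0" if S: "S \<subseteq> insert h V" "i \<in> S" for S
      proof (cases "h \<in> S")
        case True
        have "S - {h} \<subseteq> V" "i \<in> S - {h}" "insert h (S - {h}) = S" using True S i V by auto
        then show ?thesis using zero(2) zero0(2) m1[of "S - {h}"] by auto
      qed (use S zero0 in auto)
      then have "occ_sizes (insert h V) f i = {}" unfolding occ_sizes_def by blast
      then have "weight (insert h V) f i = 0" by (simp add: weight_def)
      then show ?thesis using nn by simp
    next
      case (pos S)
      then have "mcoeff f (insert h S) \<noteq> 0" using m1 zero0 by auto
      then show ?thesis using le1[of S] pos zero0 by simp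
    qed
  next
    case pos0: (pos S)
    show ?thesis
    proof (cases "mcoeff f1 S = 0")
      case True
      then have "mcoeff f (insert h S) \<noteq> 0" using m1 pos0 by auto
      then show ?thesis using le1[of S] pos0 nn by simp
    next
      case nz: False
      show ?thesis
      using V(1)
  proof (cases rule: weight_cases[where f = f1 and i = i])
        case zero
        then show ?thesis using nz pos0 by blast
      next
        case (pos T)
        \<comment> \<open>\<open>S\<close> also occurs in \<open>f1\<close>, where \<open>T\<close>
          has the largest size.\<close>
        have "card S \<le> card T" using pos nz pos0 by blast
        show ?thesis
        proof (cases "card S = card T")
          case True
          then show ?thesis using le0[of S] pos0 pos by simp
        next
          case False
          \<comment> \<open>\<open>T\<close> is larger than every monomial of \<open>f\<close> that
            contains \<open>i\<close> and avoids \<open>h\<close>, so its coefficient in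
            \<open>f1\<close> comes from \<open>insert h T\<close>.\<close>
          then have "mcoeff f T = 0" using pos0(5)[of T] pos \<open>card S \<le> card T\<close> by fastforce
          then have "mcoeff f (insert h T) \<noteq> 0" using m1 pos by auto
          then show ?thesis using le1[of T] pos nn by simp
        qed
      qed
    qed
  qed
  then show ?thesis unfolding f1_def .
qed

text \<open>Fix the variables of \<open>H\<close> one by one; at each stage one of the two values
  does at least as well as the average. The set \<open>\<alpha>\<close> collects the variables set
  to 1, the rest of \<open>H\<close> being set to 0.\<close>

lemma weight_restrict_many:
  assumes "finite V" "finite H" "H \<inter> V = {}"
  shows "\<exists>\<alpha>\<subseteq>H. sum (weight (V \<union> H) f) V \<le> sum (weight V (\<lambda>x. f (x \<union> \<alpha>))) V"
  using assms(2,3)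
proof (induction H arbitrary: f rule: finite_induct)
  case (insert h H)
  have "sum (weight (V \<union> insert h H) f) V
      \<le> (\<Sum>i\<in>V. (weight (V \<union> H) f i + weight (V \<union> H) (\<lambda>x. f (insert h x)) i) / 2)"
    using insert assms(1) weight_restrict[of "V \<union> H" h _ f] by (intro sum_mono) auto
  also have "\<dots> = (sum (weight (V \<union> H) f) V + sum (weight (V \<union> H) (\<lambda>x. f (insert h x))) V) / 2"
    by (simp add: sum.distrib flip: sum_divide_distrib)
  finally have *: "sum (weight (V \<union> insert h H) f) V \<le> \<dots>" .
  obtain \<alpha> where a: "\<alpha> \<subseteq> H" "sum (weight (V \<union> H) f) V \<le> sum (weight V (\<lambda>x. f (x \<union> \<alpha>))) V"
    using insert.IH[of f] insert.prems by auto
  obtain \<beta> where b: "\<beta> \<subseteq> H" "sum (weight (V \<union> H) (\<lambda>x. f (insert h x))) V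
      \<le> sum (weight V (\<lambda>x. f (x \<union> insert h \<beta>))) V"
    using insert.IH[of "\<lambda>x. f (insert h x)"] insert.prems by auto
  have average: "l \<le> t \<or> l \<le> u" if "l \<le> (p + q) / 2" "p \<le> t" "q \<le> u" for l p q t u :: real
    using that by argo
  from average[OF * a(2) b(2)] show ?case
  proof
    assume "sum (weight (V \<union> insert h H) f) V \<le> sum (weight V (\<lambda>x. f (x \<union> \<alpha>))) V"
    then show ?thesis using a(1) by blast
  next
    assume "sum (weight (V \<union> insert h H) f) V \<le> sum (weight V (\<lambda>x. f (x \<union> insert h \<beta>))) V"
    then show ?thesis using b(1) by (intro exI[of _ "insert h \<beta>"]) auto
  qed
qed auto

section \<open>Hitting sets and bounds on the total weight\<close>

lemma mcoeff_restrict: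
  assumes "finite S" "finite A" "A \<inter> S = {}"
  shows "mcoeff (\<lambda>x. f (x \<union> A)) S = (\<Sum>T\<in>Pow A. mcoeff f (S \<union> T))"
  using assms(2,3)
proof (induction A arbitrary: f rule: finite_induct)
  case (insert h A)
  have "mcoeff (\<lambda>x. f (x \<union> insert h A)) S = (\<Sum>T\<in>Pow A. mcoeff (\<lambda>x. f (insert h x)) (S \<union> T))"
    using insert.IH[of "\<lambda>x. f (insert h x)"] insert.prems by simp
  also have "\<dots> = (\<Sum>T\<in>Pow A. mcoeff f (S \<union> T) + mcoeff f (insert h (S \<union> T)))"
    using insert assms(1) by (intro sum.cong refl mcoeff_insert_diff) (auto intro: finite_subset)
  finally show ?case unfolding sum_Pow_insert[OF insert.hyps] by simp
qed simp

text \<open>A monomial \<open>S\<close> of the restriction comes from some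
  \<open>S \<union> T\<close> in \<open>f\<close> with \<open>T \<subseteq> A\<close>. If
  \<open>S\<close> had size \<open>Suc d\<close>, the degree bound would force
  \<open>S \<union> T = S\<close>, a top monomial of \<open>f\<close> missing
  \<open>H\<close>.\<close>

lemma deg_on_restrict:
  assumes "finite V" "deg_on V (Suc d) f" "H \<subseteq> V" "A \<subseteq> H"
    and hit: "\<And>S. S \<subseteq> V \<Longrightarrow> mcoeff f S \<noteq> 0 \<Longrightarrow> card S = Suc d \<Longrightarrow> S \<inter> H \<noteq> {}"
  shows "deg_on (V - H) d (\<lambda>x. f (x \<union> A))"
  unfolding deg_on_def
proof (intro allI impI)
  fix S assume S: "S \<subseteq> V - H" "mcoeff (\<lambda>x. f (x \<union> A)) S \<noteq> 0"
  have fin: "finite S" "finite A" using assms S by (meson Diff_subset finite_subset subset_trans)+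
  have "(\<Sum>T\<in>Pow A. mcoeff f (S \<union> T)) \<noteq> 0"
    using mcoeff_restrict[OF fin, of f] S assms(4) by (metis (no_types, lifting) Diff_disjoint disjoint_iff subsetD DiffE)
  then obtain T where T: "T \<subseteq> A" "mcoeff f (S \<union> T) \<noteq> 0"
    by (metis (no_types, lifting) PowD sum.neutral)
  have sub: "S \<union> T \<subseteq> V" using S T assms by auto
  have le: "card (S \<union> T) \<le> Suc d" using assms(2) T sub unfolding deg_on_def by blast
  have finT: "finite T" using T fin finite_subset by auto
  show "card S \<le> d"
  proof (rule ccontr)
    assume "\<not> card S \<le> d"
    moreover have "card S \<le> card (S \<union> T)" using fin finT by (intro card_mono) auto
    ultimately have "card S = Suc d" "card (S \<union> T) = Suc d" using le by auto
    then have "S = S \<union> T" using fin finT by (intro card_subset_eq) auto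
    then show False using hit[of S] T S \<open>card S = Suc d\<close> by auto
  qed
qed

text \<open>The derivative of \<open>f\<close> in direction \<open>i\<close> has degree one less
  than the largest monomial containing \<open>i\<close>. By \<open>card_nonzero_ge\<close> the
  influence of \<open>i\<close> is therefore at least twice its weight, while the total influence is
  at most \<open>d\<close>.\<close>

lemma weight_sum_le_half_degree:
  assumes V: "finite V" and f: "bool_on V f" "deg_on V d f"
  shows "(\<Sum>i\<in>V. weight V f i) \<le> real d / 2"
proof -
  \<comment> \<open>Passing to values 1 and -1 makes the sum of squares exactly
    \<open>2 ^ card V\<close>.\<close>
  define g where "g x = 1 + (-2) * f x" for x
  have mg: "mcoeff g S = mcoeff (\<lambda>x. 1) S - 2 * mcoeff f S" for S
    using mcoeff_linear[of 1 "\<lambda>x. 1" "-2" f S] unfolding g_def by simp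
  have m1: "mcoeff (\<lambda>x. 1) S = 0" if "finite S" "S \<noteq> {}" for S :: "'a set"
    using mcoeff_monom[OF that(1), of 1 "{}"] that by simp
  have "deg_on V d g" unfolding deg_on_def
  proof (intro allI impI)
    fix S assume S: "S \<subseteq> V" "mcoeff g S \<noteq> 0"
    show "card S \<le> d"
    proof (cases "S = {}")
      case False
      then have "mcoeff f S \<noteq> 0" using S m1[of S] mg[of S] V finite_subset by fastforce
      then show ?thesis using S f(2) unfolding deg_on_def by blast
    qed simp
  qed
  from total_influence_bound[OF V this]
  have "(\<Sum>x\<in>Pow V. \<Sum>i\<in>V. (g (insert i x) - g (x - {i}))\<^sup>2) \<le> 4 * real d * (\<Sum>x\<in>Pow V. (g x)\<^sup>2)" .
  moreover have "(\<Sum>x\<in>Pow V. (g x)\<^sup>2) = 2 ^ card V"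
  proof -
    have "(\<Sum>x\<in>Pow V. (g x)\<^sup>2) = (\<Sum>x\<in>Pow V. 1)"
    proof (rule sum.cong[OF refl])
      fix x assume "x \<in> Pow V"
      then have "f x \<in> {0, 1}" using f(1) unfolding bool_on_def by blast
      then show "(g x)\<^sup>2 = 1" by (auto simp: g_def)
    qed
    then show ?thesis using V by (simp add: card_Pow)
  qed
  moreover have "(\<Sum>x\<in>Pow V. \<Sum>i\<in>V. (g (insert i x) - g (x - {i}))\<^sup>2)
      = (\<Sum>i\<in>V. \<Sum>x\<in>Pow V. (g (insert i x) - g (x - {i}))\<^sup>2)"
    by (rule sum.swap)
  moreover have "8 * 2 ^ card V * weight V f i \<le> (\<Sum>x\<in>Pow V. (g (insert i x) - g (x - {i}))\<^sup>2)"
    if i: "i \<in> V" for i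
  proof -
    define D where "D x = f (insert i x) - f x" for x
    define V' where "V' = V - {i}"
    have V': "finite V'" "i \<notin> V'" "insert i V' = V" using V i by (auto simp: V'_def)
    have cV: "card V = Suc (card V')" using V' by (metis card_insert_disjoint)
    have mD: "mcoeff D S = mcoeff f (insert i S)" if "S \<subseteq> V'" for S
    proof -
      have "finite S" "i \<notin> S" using that V' finite_subset by auto
      then show ?thesis using mcoeff_linear[of 1 "\<lambda>x. f (insert i x)" "-1" f S] mcoeff_insert[of S i f]
        unfolding D_def by simp
    qed
    have val: "D x \<noteq> 0 \<Longrightarrow> (D x)\<^sup>2 = 1" if "x \<subseteq> V'" for x
    proof -
      have "x \<subseteq> V" "insert i x \<subseteq> V" using that V' by auto
      then have "f x \<in> {0,1}" "f (insert i x) \<in> {0,1}" using f(1) unfolding bool_on_def by blast+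
      then show "D x \<noteq> 0 \<Longrightarrow> (D x)\<^sup>2 = 1" unfolding D_def by auto
    qed
    have "(\<Sum>x\<in>Pow V. (g (insert i x) - g (x - {i}))\<^sup>2)
        = (\<Sum>x\<in>Pow (insert i V'). (g (insert i x) - g (x - {i}))\<^sup>2)" using V' by simp
    also have "\<dots> = (\<Sum>x\<in>Pow V'. (g (insert i x) - g (x - {i}))\<^sup>2 + (g (insert i (insert i x)) - g (insert i x - {i}))\<^sup>2)"
      using V' by (intro sum_Pow_insert)
    \<comment> \<open>The 8 arises because each edge in direction \<open>i\<close> is seen from both
      ends and \<open>g\<close> changes by twice \<open>D x\<close> along it.\<close>
    also have "\<dots> = (\<Sum>x\<in>Pow V'. 8 * (D x)\<^sup>2)"
    proof (rule sum.cong[OF refl])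
      fix x assume "x \<in> Pow V'"
      then have "x - {i} = x" "insert i x - {i} = x" using V' by auto
      then show "(g (insert i x) - g (x - {i}))\<^sup>2 + (g (insert i (insert i x)) - g (insert i x - {i}))\<^sup>2 = 8 * (D x)\<^sup>2"
        by (simp add: g_def D_def power2_eq_square algebra_simps)
    qed
    also have "\<dots> = (\<Sum>x | x \<subseteq> V' \<and> D x \<noteq> 0. 8)"
      using V' val by (intro sum.mono_neutral_cong_right) auto
    finally have infl: "(\<Sum>x\<in>Pow V. (g (insert i x) - g (x - {i}))\<^sup>2) = 8 * real (card {x. x \<subseteq> V' \<and> D x \<noteq> 0})"
      by simp
    show ?thesis
    using V
  proof (cases rule: weight_cases[where f = f and i = i])
      case zero
      then show ?thesis unfolding infl by simp
    next
      case (pos S)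
      have S: "S - {i} \<subseteq> V'" "insert i (S - {i}) = S" using pos V' by auto
      obtain e where e: "card S = Suc e"
        using pos V by (metis card.remove finite_subset)
      have "deg_on V' e D" unfolding deg_on_def
      proof (intro allI impI)
        fix T assume T: "T \<subseteq> V'" "mcoeff D T \<noteq> 0"
        then have "card (insert i T) \<le> card S" using pos(5)[of "insert i T"] mD V' by auto
        moreover have "finite T" "i \<notin> T" using T V' finite_subset by auto
        ultimately show "card T \<le> e" using e by simp
      qed
      from card_nonzero_ge[OF V'(1) this S(1)]
      have "2 ^ card V' \<le> 2 ^ e * card {x. x \<subseteq> V' \<and> D x \<noteq> 0}"
        using mD[OF S(1)] S pos by simp
      then have "real (2 ^ card V') \<le> real (2 ^ e * card {x. x \<subseteq> V' \<and> D x \<noteq> 0})"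
        by (simp only: of_nat_le_iff)
      then have "2 ^ card V' / 2 ^ e \<le> real (card {x. x \<subseteq> V' \<and> D x \<noteq> 0})"
        by (simp add: divide_le_eq mult.commute)
      then show ?thesis unfolding infl pos(4) e cV by (simp add: power_divide field_simps)
    qed
  qed
  then have "(\<Sum>i\<in>V. 8 * 2 ^ card V * weight V f i) \<le> (\<Sum>i\<in>V. \<Sum>x\<in>Pow V. (g (insert i x) - g (x - {i}))\<^sup>2)"
    by (intro sum_mono)
  ultimately have "8 * 2 ^ card V * (\<Sum>i\<in>V. weight V f i) \<le> 4 * real d * 2 ^ card V"
    by (simp add: sum_distrib_left)
  then have "2 ^ card V * (8 * (\<Sum>i\<in>V. weight V f i)) \<le> 2 ^ card V * (4 * real d)"
    by (simp add: mult_ac)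
  then have "8 * (\<Sum>i\<in>V. weight V f i) \<le> 4 * real d"
    by (subst (asm) mult_le_cancel_left_pos) auto
  then show ?thesis by simp
qed

text \<open>Each member of \<open>F\<close> contains a block whose flip changes \<open>f {}\<close>.
  Identifying the variables of each block and fixing all others to 0 gives a function on subsets of
  \<open>F\<close>, of degree at most \<open>d\<close> and sensitive to every variable at the empty
  set; \<open>sensitivity_bound\<close> applies.\<close>

lemma disjoint_max_monomials_bound:
  assumes V: "finite V" and f: "bool_on V f" "deg_on V d f" and d: "1 \<le> d"
    and F: "\<And>S. S \<in> F \<Longrightarrow> S \<subseteq> V \<and> mcoeff f S \<noteq> 0 \<and> card S = d" "pairwise disjnt F"
  shows "card F \<le> d\<^sup>2"
proof -
  have finF: "finite F" using F(1) V by (meson PowI finite_Pow_iff finite_subset subsetI)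
  \<comment> \<open>Were \<open>f\<close> constant on the subsets of \<open>S\<close>, the
    coefficient of the nonempty set \<open>S\<close> would vanish.\<close>
  have "\<exists>B. B \<subseteq> S \<and> f B \<noteq> f {}" if S: "S \<in> F" for S
  proof (rule ccontr)
    assume "\<not> (\<exists>B. B \<subseteq> S \<and> f B \<noteq> f {})"
    then have "f x = f {} * of_bool ({} \<subseteq> x)" if "x \<subseteq> S" for x
      using that by (simp only: empty_subsetI of_bool_eq mult_1_right) blast
    then have "mcoeff f S = mcoeff (\<lambda>x. f {} * of_bool ({} \<subseteq> x)) S"
      by (rule mcoeff_cong)
    moreover have "finite S" using F(1)[OF S] V finite_subset by auto
    moreover have "S \<noteq> {}" using F(1)[OF S] d by auto
    ultimately show False using F(1)[OF S] by (simp only: mcoeff_monom) simp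
  qed
  then obtain B where B: "\<And>S. S \<in> F \<Longrightarrow> B S \<subseteq> S \<and> f (B S) \<noteq> f {}" by metis
  define owner where "owner v = (SOME S. S \<in> F \<and> v \<in> B S)" for v
  define U where "U = (\<Union>S\<in>F. B S)"
  have owner: "owner v = S" if "S \<in> F" "v \<in> B S" for v S
  proof -
    have "owner v \<in> F \<and> v \<in> B (owner v)" unfolding owner_def using that by (metis (mono_tags, lifting) someI)
    then have "v \<in> S" "v \<in> owner v" "owner v \<in> F" using B that by blast+
    then show ?thesis using F(2) that unfolding pairwise_def disjnt_def by blast
  qed
  obtain p where p: "deg_le d p" "\<And>x. x \<subseteq> V \<Longrightarrow> p x = f x"
    using deg_le_of_deg_on[OF f(2) V] by blast
  \<comment> \<open>The affine map is exclusive-or with the bit \<open>f {}\<close>, which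
    normalizes \<open>g {}\<close> to 0.\<close>
  define g where "g Y = f {} + (1 - 2 * f {}) * p {v \<in> U. of_bool (owner v \<in> Y) = (1 :: real)}" for Y
  have UV: "U \<subseteq> V" unfolding U_def using B F(1) by blast
  have f01: "f x \<in> {0, 1}" if "x \<subseteq> V" for x using f(1) that unfolding bool_on_def by blast
  have g: "g Y = f {} + (1 - 2 * f {}) * f {v \<in> U. owner v \<in> Y}" for Y
  proof -
    have "{v \<in> U. of_bool (owner v \<in> Y) = (1 :: real)} = {v \<in> U. owner v \<in> Y}" by auto
    moreover have "{v \<in> U. owner v \<in> Y} \<subseteq> V" using UV by blast
    ultimately show ?thesis unfolding g_def using p(2) by simp
  qed
  show ?thesis
  proof (rule sensitivity_bound[OF finF _ _ d])
    have "deg_le (d * 1) (\<lambda>Y. p {v \<in> U. of_bool (owner v \<in> Y) = (1 :: real)})"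
      by (rule deg_le_subst[OF p(1)]) (auto intro: deg_le_var)
    then show "deg_le d g" unfolding g_def using deg_le.add[OF deg_le_const deg_le_cmult] by simp
    show "bool_on F g" unfolding bool_on_def
    proof (intro allI impI)
      fix Y
      have "{v \<in> U. owner v \<in> Y} \<subseteq> V" using UV by blast
      then show "g Y \<in> {0, 1}" unfolding g using f01[of "{v \<in> U. owner v \<in> Y}"] f01[of "{}"] by auto
    qed
    show "g {} = 0" unfolding g using f01[of "{}"] by auto
    fix S assume S: "S \<in> F"
    have "{v \<in> U. owner v \<in> {S}} = B S"
      using owner S unfolding U_def by auto
    moreover have "B S \<subseteq> V" using B F(1) S by blast
    ultimately show "g {S} = 1" unfolding g using f01[of "{}"] f01[of "B S"] B[OF S] by auto
  qed
qed

lemma small_hitting_set: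
  assumes V: "finite V" and f: "bool_on V f" "deg_on V d f" and d: "1 \<le> d"
  shows "\<exists>H\<subseteq>V. card H \<le> d ^ 3 \<and> (\<forall>i\<in>H. weight V f i \<le> (1/2) ^ d) \<and>
    (\<forall>S. S \<subseteq> V \<longrightarrow> mcoeff f S \<noteq> 0 \<longrightarrow> card S = d \<longrightarrow> S \<inter> H \<noteq> {})"
proof -
  define M where "M = {S. S \<subseteq> V \<and> mcoeff f S \<noteq> 0 \<and> card S = d}"
  have "finite M" unfolding M_def using V by simp
  define D where "D = {F. F \<subseteq> M \<and> pairwise disjnt F}"
  have "finite D" unfolding D_def using \<open>finite M\<close> by simp
  moreover have "D \<noteq> {}" unfolding D_def by force
  ultimately obtain F where FD: "F \<in> D" and maxD: "\<forall>G\<in>D. F \<subseteq> G \<longrightarrow> F = G"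
    using finite_has_maximal[of D] by blast
  have F: "F \<subseteq> M" "pairwise disjnt F" using FD unfolding D_def by auto
  have max: "F = G" if "G \<subseteq> M" "pairwise disjnt G" "F \<subseteq> G" for G
    using maxD that unfolding D_def by blast
  have finF: "finite F" using F \<open>finite M\<close> finite_subset by blast
  have "card F \<le> d\<^sup>2"
    using F by (intro disjoint_max_monomials_bound[OF V f d]) (auto simp: M_def)
  moreover have "card (\<Union>F) \<le> card F * d"
  proof -
    have "card (\<Union>F) \<le> (\<Sum>S\<in>F. card S)" using card_UN_le[OF finF, of "\<lambda>S. S"] by simp
    also have "\<dots> = (\<Sum>S\<in>F. d)" using F(1) by (intro sum.cong) (auto simp: M_def)
    finally show ?thesis by simp
  qed
  ultimately have "card (\<Union>F) \<le> d\<^sup>2 * d" using mult_le_mono1 order_trans by blast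
  then have "card (\<Union>F) \<le> d ^ 3" by (simp add: power3_eq_cube power2_eq_square)
  moreover have "\<Union>F \<subseteq> V" using F(1) unfolding M_def by blast
  moreover have "weight V f i \<le> (1/2) ^ d" if i: "i \<in> \<Union>F" for i
  proof -
    obtain S where "i \<in> S" "S \<in> F" using i by blast
    then have "S \<subseteq> V" "mcoeff f S \<noteq> 0" "card S = d" using F(1) unfolding M_def by blast+
    then show ?thesis using weight_le[OF V, of S i f d] \<open>i \<in> S\<close> by simp
  qed
  moreover have "S \<inter> \<Union>F \<noteq> {}" if "S \<subseteq> V" "mcoeff f S \<noteq> 0" "card S = d" for S
  proof
    assume disj: "S \<inter> \<Union>F = {}"
    have "S \<in> M" using that by (simp add: M_def)
    \<comment> \<open>A top monomial missing the union could be added to the maximal family.\<close>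
    then have "F = insert S F" using F disj
      by (intro max) (auto simp: pairwise_insert disjnt_def)
    then have "S \<subseteq> \<Union>F" by blast
    then have "S = {}" using disj by blast
    then show False using that d by simp
  qed
  ultimately show ?thesis by blast
qed

text \<open>Outside the hitting set \<open>H\<close> the weight is bounded by that of a restriction
  of degree \<open>d\<close>; each variable in \<open>H\<close> costs at most 1 / 2^(d+1). The
  assumption ranges over all finite sets because the restriction lives on
  \<open>V - H\<close>.\<close>

lemma weight_sum_step:
  fixes V :: "'a set"
  assumes IH: "\<And>(V :: 'a set) f. finite V \<Longrightarrow> bool_on V f \<Longrightarrow> deg_on V d f \<Longrightarrow> (\<Sum>i\<in>V. weight V f i) \<le> B"
    and V: "finite V" and f: "bool_on V f" "deg_on V (Suc d) f"
  shows "(\<Sum>i\<in>V. weight V f i) \<le> B + real (Suc d) ^ 3 / 2 ^ Suc d"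
proof -
  obtain H where H: "H \<subseteq> V" "card H \<le> Suc d ^ 3" "\<And>i. i \<in> H \<Longrightarrow> weight V f i \<le> (1/2) ^ Suc d"
    and hit: "\<And>S. S \<subseteq> V \<Longrightarrow> mcoeff f S \<noteq> 0 \<Longrightarrow> card S = Suc d \<Longrightarrow> S \<inter> H \<noteq> {}"
    using small_hitting_set[OF V f] by auto
  have finH: "finite H" using H(1) V finite_subset by blast
  have "(\<Sum>i\<in>H. weight V f i) \<le> real (card H) * (1/2) ^ Suc d"
    using sum_bounded_above[of H "weight V f"] H(3) by blast
  also have "\<dots> \<le> real (Suc d ^ 3) * (1/2) ^ Suc d"
    using H(2) by (intro mult_right_mono) (auto simp del: of_nat_power)
  also have "\<dots> = real (Suc d) ^ 3 / 2 ^ Suc d" by (simp add: power_one_over)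
  finally have inH: "(\<Sum>i\<in>H. weight V f i) \<le> real (Suc d) ^ 3 / 2 ^ Suc d" .
  have "V - H \<union> H = V" using H(1) by blast
  then obtain \<alpha> where a: "\<alpha> \<subseteq> H"
    and le: "(\<Sum>i\<in>V - H. weight V f i) \<le> (\<Sum>i\<in>V - H. weight (V - H) (\<lambda>x. f (x \<union> \<alpha>)) i)"
    using weight_restrict_many[of "V - H" H f] V finH by auto
  note le
  also have "(\<Sum>i\<in>V - H. weight (V - H) (\<lambda>x. f (x \<union> \<alpha>)) i) \<le> B"
  proof (rule IH)
    show "bool_on (V - H) (\<lambda>x. f (x \<union> \<alpha>))"
      unfolding bool_on_def
    proof (intro allI impI)
      fix x assume "x \<subseteq> V - H"
      then have "x \<union> \<alpha> \<subseteq> V" using a(1) H(1) by blast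
      then show "f (x \<union> \<alpha>) \<in> {0, 1}" using f(1) unfolding bool_on_def by blast
    qed
    show "deg_on (V - H) d (\<lambda>x. f (x \<union> \<alpha>))"
      using deg_on_restrict[OF V f(2) H(1) a(1) hit] by blast
  qed (use V in simp)
  finally have "(\<Sum>i\<in>V - H. weight V f i) \<le> B" .
  moreover have "(\<Sum>i\<in>V. weight V f i) = (\<Sum>i\<in>V - H. weight V f i) + (\<Sum>i\<in>H. weight V f i)"
    using H(1) V by (rule sum.subset_diff)
  ultimately show ?thesis using inH by linarith
qed

text \<open>The bound \<open>d / 2\<close> is the better one up to degree 11; afterwards the increments
  \<open>d\<^sup>3 / 2\<^sup>d\<close> are smaller than \<open>1 / 2\<close>, and
  \<open>\<Sum>\<^sub>k\<^sub>>\<^sub>d k\<^sup>3 / 2\<^sup>k = (d\<^sup>3 + 6 d\<^sup>2 + 18 d + 26) / 2\<^sup>d\<close>.\<close>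

lemma weight_sum_bound_large:
  assumes "11 \<le> d" "finite V" "bool_on V f" "deg_on V d f"
  shows "(\<Sum>i\<in>V. weight V f i)
    \<le> 11 / 2 + 2281 / 2048 - (real d ^ 3 + 6 * real d ^ 2 + 18 * real d + 26) / 2 ^ d"
  using assms
proof (induction d arbitrary: V f rule: dec_induct)
  case base
  \<comment> \<open>At degree 11 the subtracted tail is exactly 2281 / 2048, so the claim is the
    bound 11 / 2.\<close>
  then have "(\<Sum>i\<in>V. weight V f i) \<le> real 11 / 2" by (intro weight_sum_le_half_degree)
  then show ?case by simp
next
  case (step d)
  define B where "B = 11 / 2 + 2281 / 2048 - (real d ^ 3 + 6 * real d ^ 2 + 18 * real d + 26) / 2 ^ d"
  have "(\<Sum>i\<in>V. weight V f i) \<le> B + real (Suc d) ^ 3 / 2 ^ Suc d"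
    using step.IH step.prems unfolding B_def by (intro weight_sum_step) auto
  also have "\<dots> = 11 / 2 + 2281 / 2048
      - (real (Suc d) ^ 3 + 6 * real (Suc d) ^ 2 + 18 * real (Suc d) + 26) / 2 ^ Suc d"
    \<comment> \<open>The tail at \<open>d\<close> is the tail at \<open>Suc d\<close> plus the
      increment \<open>(Suc d)^3 / 2^(Suc d)\<close>.\<close>
    unfolding B_def by (simp add: field_simps power3_eq_cube power2_eq_square)
  finally show ?case .
qed

lemma weight_sum_bound:
  assumes "finite V" "bool_on V f" "deg_on V d f"
  shows "(\<Sum>i\<in>V. weight V f i) \<le> 6.614"
proof (cases "11 \<le> d")
  case True
  have "0 \<le> (real d ^ 3 + 6 * real d ^ 2 + 18 * real d + 26) / 2 ^ d" by simp
  then have "(\<Sum>i\<in>V. weight V f i) \<le> 11 / 2 + 2281 / 2048"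
    using weight_sum_bound_large[OF True assms] by linarith
  \<comment> \<open>The sum is about 6.61377, which is where 6.614 comes from.\<close>
  then show ?thesis by simp
next
  case False
  then show ?thesis using weight_sum_le_half_degree[OF assms] by simp
qed

section \<open>Numbers of relevant variables\<close>

lemma prod_indicator:
  "finite S \<Longrightarrow> (\<Prod>i\<in>S. (if i \<in> x then 1 else 0)) = (of_bool (S \<subseteq> x) :: real)"
  by (induction S rule: finite_induct) auto

text \<open>On 0/1 points the product of indicators tests \<open>S \<subseteq> x\<close>, so the
  representation is a subset sum: existence follows from \<open>sum_mcoeff\<close>, uniqueness from
  \<open>mcoeff_unique\<close>. The clause on sets outside the cube makes the described function
  unique everywhere.\<close>

lemma ml_coeff_eq: "ml_coeff n f S = (if S \<subseteq> {0..<n} then mcoeff f S else 0)"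
proof -
  let ?V = "{0..<n}"
  let ?P = "\<lambda>c. (\<forall>S. \<not> S \<subseteq> ?V \<longrightarrow> c S = 0) \<and>
     (\<forall>x. x \<subseteq> ?V \<longrightarrow> f x = (\<Sum>S\<in>Pow ?V. c S * (\<Prod>i\<in>S. (if i \<in> x then 1 else 0))))"
  have expand: "(\<Sum>S\<in>Pow ?V. c S * (\<Prod>i\<in>S. (if i \<in> x then 1 else 0))) = (\<Sum>S\<in>Pow x. c S)"
    if x: "x \<subseteq> ?V" for c :: "nat set \<Rightarrow> real" and x
  proof -
    have "(\<Sum>S\<in>Pow ?V. c S * (\<Prod>i\<in>S. (if i \<in> x then 1 else 0)))
        = (\<Sum>S\<in>Pow ?V. c S * of_bool (S \<subseteq> x))"
      using finite_subset by (intro sum.cong refl arg_cong2[where f = "(*)"] prod_indicator) auto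
    also have "\<dots> = (\<Sum>S\<in>Pow x. c S)"
      using x by (intro sum.mono_neutral_cong_right) auto
    finally show ?thesis .
  qed
  have "(THE c. ?P c) = (\<lambda>S. if S \<subseteq> ?V then mcoeff f S else 0)"
  proof (rule the_equality)
    have "f x = (\<Sum>S\<in>Pow x. if S \<subseteq> ?V then mcoeff f S else 0)" if x: "x \<subseteq> ?V" for x
    proof -
      have "(\<Sum>S\<in>Pow x. if S \<subseteq> ?V then mcoeff f S else 0) = (\<Sum>S\<in>Pow x. mcoeff f S)"
        using x by (intro sum.cong) auto
      then show ?thesis using sum_mcoeff[of x f] x finite_subset[OF x] by simp
    qed
    then have "f x = (\<Sum>S\<in>Pow ?V. (if S \<subseteq> ?V then mcoeff f S else 0) * (\<Prod>i\<in>S. (if i \<in> x then 1 else 0)))"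
      if "x \<subseteq> ?V" for x
      using that expand[OF that, of "\<lambda>S. if S \<subseteq> ?V then mcoeff f S else 0"] by (simp only:)
    then show "?P (\<lambda>S. if S \<subseteq> ?V then mcoeff f S else 0)"
      by (intro conjI allI impI) (simp_all only: if_False)
  next
    fix c assume c: "?P c"
    show "c = (\<lambda>S. if S \<subseteq> ?V then mcoeff f S else 0)"
    proof
      fix S
      show "c S = (if S \<subseteq> ?V then mcoeff f S else 0)"
      proof (cases "S \<subseteq> ?V")
        case True
        have "mcoeff f S = mcoeff (\<lambda>x. \<Sum>T\<in>Pow x. c T) S"
        proof (rule mcoeff_cong)
          fix x assume "x \<subseteq> S"
          then have "x \<subseteq> ?V" using True by blast
          then show "f x = (\<Sum>T\<in>Pow x. c T)" using c expand by simp
        qed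
        also have "\<dots> = c S" using finite_subset[OF True] by (intro mcoeff_unique) simp
        finally show ?thesis using True by simp
      qed (use c in simp)
    qed
  qed
  then show ?thesis unfolding ml_coeff_def by simp
qed

lemma bdeg_le_iff: "bdeg n f \<le> d \<longleftrightarrow> deg_on {0..<n} d f"
proof -
  have "{card S | S. S \<subseteq> {0..<n} \<and> ml_coeff n f S \<noteq> 0} \<subseteq> card ` Pow {0..<n}" by auto
  then have "finite {card S | S. S \<subseteq> {0..<n} \<and> ml_coeff n f S \<noteq> 0}"
    by (rule finite_subset) simp
  then show ?thesis unfolding bdeg_def deg_on_def by (auto simp: ml_coeff_eq)
qed

lemma is_boolean_fun_iff: "is_boolean_fun n f \<longleftrightarrow> bool_on {0..<n} f"
  by (simp add: is_boolean_fun_def bool_on_def)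

lemma relevant_vars_eq:
  "relevant_vars n f = {i. i < n \<and> (\<exists>S. i \<in> S \<and> S \<subseteq> {0..<n} \<and> mcoeff f S \<noteq> 0)}"
  unfolding relevant_vars_def by (simp add: ml_coeff_eq cong: conj_cong)

text \<open>The coefficients of monomials containing \<open>i\<close> are those of the derivative in
  direction \<open>i\<close>, which vanishes only if all of them do. This form suits explicit
  constructions.\<close>

lemma relevant_vars_iff:
  "i \<in> relevant_vars n f \<longleftrightarrow> i < n \<and> (\<exists>x \<subseteq> {0..<n}. f (insert i x) \<noteq> f x)"
proof
  assume "i \<in> relevant_vars n f"
  then obtain S where S: "i < n" "i \<in> S" "S \<subseteq> {0..<n}" "mcoeff f S \<noteq> 0"
    unfolding relevant_vars_eq by blast
  have fin: "finite (S - {i})" using S finite_subset by blast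
  have "\<exists>x \<subseteq> {0..<n}. f (insert i x) \<noteq> f x"
  proof (rule ccontr)
    assume *: "\<not> (\<exists>x \<subseteq> {0..<n}. f (insert i x) \<noteq> f x)"
    have "mcoeff f (insert i (S - {i})) = mcoeff (\<lambda>x. f (insert i x)) (S - {i}) - mcoeff f (S - {i})"
      using fin by (intro mcoeff_insert) auto
    also have "mcoeff (\<lambda>x. f (insert i x)) (S - {i}) = mcoeff f (S - {i})"
      using * S by (intro mcoeff_cong) blast
    finally show False using S by (simp add: insert_absorb)
  qed
  then show "i < n \<and> (\<exists>x \<subseteq> {0..<n}. f (insert i x) \<noteq> f x)" using S by blast
next
  assume "i < n \<and> (\<exists>x \<subseteq> {0..<n}. f (insert i x) \<noteq> f x)"
  then obtain x where i: "i < n" and x: "x \<subseteq> {0..<n}" "f (insert i x) \<noteq> f x" by blast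
  let ?D = "\<lambda>x. 1 * f (insert i x) + (-1) * f x"
  have "i \<notin> x" using x by (auto simp: insert_absorb)
  then have "x \<subseteq> {0..<n} - {i}" "?D x \<noteq> 0" using x by auto
  then obtain S where S: "S \<subseteq> {0..<n} - {i}" "mcoeff ?D S \<noteq> 0"
    using mcoeff_all_zero[of "{0..<n} - {i}" ?D x] by auto
  moreover have "finite S" "i \<notin> S" using S finite_subset by auto
  ultimately have "mcoeff f (insert i S) \<noteq> 0"
    unfolding mcoeff_linear by (simp add: mcoeff_insert)
  then show "i \<in> relevant_vars n f"
    using S i unfolding relevant_vars_eq by (intro CollectI conjI exI[of _ "insert i S"]) auto
qed

lemma finite_relevant_vars: "finite (relevant_vars n f)"
  unfolding relevant_vars_def by simp

text \<open>Every relevant variable has weight at least \<open>(1/2) ^ d\<close>, so the bound on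
  the total weight limits their number.\<close>

lemma num_relevant_le:
  assumes "is_boolean_fun n f" "bdeg n f \<le> d"
  shows "real (num_relevant n f) \<le> 6.614 * 2 ^ d"
proof -
  let ?V = "{0..<n}"
  have f: "bool_on ?V f" "deg_on ?V d f"
    using assms by (simp_all add: is_boolean_fun_iff bdeg_le_iff)
  have "(1/2) ^ d \<le> weight ?V f i" if i: "i \<in> relevant_vars n f" for i
  proof -
    obtain S where S: "i \<in> S" "S \<subseteq> ?V" "mcoeff f S \<noteq> 0"
      using i unfolding relevant_vars_eq by blast
    have "finite ?V" by simp
    then show ?thesis
    proof (cases rule: weight_cases[where f = f and i = i])
      case zero
      then show ?thesis using S by blast
    next
      case (pos T)
      then have "card T \<le> d" using f(2) unfolding deg_on_def by blast
      then show ?thesis unfolding pos(4) by (intro power_decreasing) auto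
    qed
  qed
  then have "real (num_relevant n f) * (1/2) ^ d \<le> (\<Sum>i\<in>relevant_vars n f. weight ?V f i)"
    unfolding num_relevant_def by (intro sum_bounded_below)
  also have "\<dots> \<le> (\<Sum>i\<in>?V. weight ?V f i)"
    by (intro sum_mono2) (auto simp: relevant_vars_def weight_nonneg)
  also have "\<dots> \<le> 6.614" using f by (intro weight_sum_bound) auto
  finally have "real (num_relevant n f) * (1/2) ^ d \<le> 6.614" .
  then show ?thesis by (simp add: power_one_over divide_le_eq)
qed

text \<open>Doubling the number of variables at the cost of one degree: two control variables
  \<open>s\<close>, \<open>t\<close> choose between \<open>f x\<close> and \<open>f y\<close> (if \<open>s = t\<close>, the former) and \<open>s\<close> negates the value.
  The coefficient of \<open>s t\<close> cancels because \<open>f x + (1 - f x) = f y + (1 - f y)\<close>.\<close>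

definition selector :: "nat \<Rightarrow> (nat set \<Rightarrow> real) \<Rightarrow> nat set \<Rightarrow> real" where
  "selector n f z =
    (let x = f {i \<in> {0..<n}. i \<in> z}; y = f {i \<in> {0..<n}. n + i \<in> z};
         s = of_bool (2 * n \<in> z); t = of_bool (2 * n + 1 \<in> z)
     in x + s * (1 - y - x) + t * (y - x))"

lemma selector_boolean:
  assumes "is_boolean_fun n f"
  shows "is_boolean_fun m (selector n f)"
proof -
  have f: "f {i \<in> {0..<n}. Q i} \<in> {0, 1}" for Q
  proof -
    have "{i \<in> {0..<n}. Q i} \<subseteq> {0..<n}" by blast
    then show ?thesis using assms unfolding is_boolean_fun_def by blast
  qed
  have "x + of_bool P * (1 - y - x) + of_bool Q * (y - x) \<in> {0, 1}"
    if "x \<in> {0, 1}" "y \<in> {0, 1}" for x y :: real and P Q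
    using that by auto
  from this[OF f f] show ?thesis unfolding is_boolean_fun_def selector_def Let_def by (intro allI impI)
qed

lemma selector_degree:
  assumes "bdeg n f \<le> d"
  shows "bdeg m (selector n f) \<le> Suc d"
proof -
  obtain p where p: "deg_le d p" "\<And>x. x \<subseteq> {0..<n} \<Longrightarrow> p x = f x"
    using assms deg_le_of_deg_on[of "{0..<n}" d f] unfolding bdeg_le_iff by auto
  have sub: "deg_le d (\<lambda>z. f {i \<in> {0..<n}. \<phi> i \<in> z})" for \<phi> :: "nat \<Rightarrow> nat"
  proof -
    have "deg_le (d * 1) (\<lambda>z. p {i \<in> {0..<n}. of_bool (\<phi> i \<in> z) = (1 :: real)})"
      by (rule deg_le_subst[OF p(1)]) (auto intro: deg_le_var)
    moreover have "p {i \<in> {0..<n}. of_bool (\<phi> i \<in> z) = (1 :: real)} = f {i \<in> {0..<n}. \<phi> i \<in> z}" for z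
      by (subst p(2)) auto
    ultimately show ?thesis by simp
  qed
  note x = sub[of "\<lambda>i. i"] and y = sub[of "\<lambda>i. n + i"]
  have var: "deg_le 1 (\<lambda>z. of_bool (k \<in> z))" for k :: nat by (simp add: deg_le_var)
  have "deg_le (1 + d) (selector n f)"
    unfolding selector_def Let_def
    by (intro deg_le.add deg_le_mult deg_le_diff deg_le_const var x y deg_le_mono[OF x]) auto
  then show ?thesis unfolding bdeg_le_iff by (intro deg_on_of_deg_le) auto
qed

text \<open>With \<open>s = 0\<close> the control \<open>t\<close> exposes \<open>f x\<close> or
  \<open>f y\<close>, so both copies of each relevant variable stay relevant. The control
  \<open>s\<close> negates the value at the empty set, and \<open>t\<close> matters because a
  relevant variable makes \<open>f\<close> nonconstant.\<close>

lemma selector_relevant: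
  assumes f: "is_boolean_fun n f" and rel: "num_relevant n f \<noteq> 0"
  shows "2 * num_relevant n f + 2 \<le> num_relevant (2 * n + 2) (selector n f)"
proof -
  let ?R = "relevant_vars n f" and ?F = "selector n f"
  let ?T = "relevant_vars (2 * n + 2) ?F"
  have relI: "i \<in> ?T" if "i < 2 * n + 2" "x \<subseteq> {0..<2 * n + 2}" "?F (insert i x) \<noteq> ?F x" for i x
    using that unfolding relevant_vars_iff by blast
  have restr: "{j. j < n \<and> j \<in> x} = x" "{j \<in> {0..<n}. j \<in> x} = x" if "x \<subseteq> {0..<n}" for x
    using that by auto
  have "i \<in> ?T \<and> n + i \<in> ?T" if i: "i \<in> ?R" for i
  proof
    obtain x where x: "i < n" "x \<subseteq> {0..<n}" "f (insert i x) \<noteq> f x"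
      using i unfolding relevant_vars_iff by blast
    have x': "insert i x \<subseteq> {0..<n}" using x by auto
    have val: "?F z = f z" if "z \<subseteq> {0..<n}" for z
    proof -
      have "2 * n \<notin> z" "2 * n + 1 \<notin> z" using that by auto
      then show ?thesis using restr[OF that] by (simp add: selector_def)
    qed
    show "i \<in> ?T" using x val[OF x(2)] val[OF x'] by (intro relI[of i x]) auto
    let ?up = "\<lambda>z. insert (2 * n + 1) ((+) n ` z)"
    have val: "?F (?up z) = f z" if "z \<subseteq> {0..<n}" for z
    proof -
      have "2 * n \<notin> ?up z" using that by auto
      moreover have "{i \<in> {0..<n}. n + i \<in> ?up z} = z" using that by auto
      ultimately show ?thesis unfolding selector_def Let_def by simp
    qed
    have "insert (n + i) (?up x) = ?up (insert i x)" by auto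
    moreover have "?up x \<subseteq> {0..<2 * n + 2}" using x by auto
    ultimately show "n + i \<in> ?T" using x val[OF x(2)] val[OF x'] by (intro relI[of "n + i" "?up x"]) auto
  qed
  moreover have "2 * n \<in> ?T"
  proof (rule relI[of _ "{}"])
    have "f {} \<in> {0, 1}" using f unfolding is_boolean_fun_def by blast
    moreover have none: "{i \<in> {0..<n}. i \<in> {2 * n}} = {}" "{i \<in> {0..<n}. n + i \<in> {2 * n}} = {}"
      "2 * n + 1 \<notin> {2 * n}" by auto
    ultimately show "?F (insert (2 * n) {}) \<noteq> ?F {}" unfolding selector_def Let_def none by auto
  qed auto
  moreover have "2 * n + 1 \<in> ?T"
  proof -
    obtain i where "i \<in> ?R" using rel unfolding num_relevant_def by (metis card.empty ex_in_conv)
    then obtain x where x: "i < n" "x \<subseteq> {0..<n}" "f (insert i x) \<noteq> f x"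
      unfolding relevant_vars_iff by blast
    then obtain y where y: "y \<subseteq> {0..<n}" "f y \<noteq> f {}"
      by (metis atLeastLessThan_iff insert_subset zero_le)
    show ?thesis
    proof (rule relI[of _ "(+) n ` y"])
      have low: "{i \<in> {0..<n}. n + i \<in> (+) n ` y} = y" "{i \<in> {0..<n}. i \<in> (+) n ` y} = {}"
        "2 * n \<notin> (+) n ` y" "2 * n + 1 \<notin> (+) n ` y" using y by auto
      have high: "{i \<in> {0..<n}. n + i \<in> insert (2 * n + 1) ((+) n ` y)} = y"
        "{i \<in> {0..<n}. i \<in> insert (2 * n + 1) ((+) n ` y)} = {}"
        "2 * n \<notin> insert (2 * n + 1) ((+) n ` y)" using y by auto
      have "?F ((+) n ` y) = f {}"
        unfolding selector_def Let_def low using low by (simp only: of_bool_eq)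
      moreover have "?F (insert (2 * n + 1) ((+) n ` y)) = f y"
        unfolding selector_def Let_def high using high(3) by (simp only: of_bool_eq insertI1) (simp only: mult_zero_left mult_1 add_0_right add_diff_cancel_left' diff_add_cancel add.commute[of "f {}"])
      ultimately show "?F (insert (2 * n + 1) ((+) n ` y)) \<noteq> ?F ((+) n ` y)" using y by simp
    qed (use y in auto)
  qed
  ultimately have "?R \<union> (+) n ` ?R \<union> {2 * n, 2 * n + 1} \<subseteq> ?T" by auto
  then have "card (?R \<union> (+) n ` ?R \<union> {2 * n, 2 * n + 1}) \<le> card ?T"
    by (intro card_mono finite_relevant_vars)
  moreover have "card (?R \<union> (+) n ` ?R \<union> {2 * n, 2 * n + 1}) = 2 * card ?R + 2"
  proof -
    have lt: "i < n" if "i \<in> ?R" for i using that unfolding relevant_vars_def by simp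
    have "card (?R \<union> (+) n ` ?R) = card ?R + card ((+) n ` ?R)"
      using finite_relevant_vars lt by (intro card_Un_disjoint) fastforce+
    moreover have "card ((+) n ` ?R) = card ?R" by (simp add: card_image)
    moreover have "card (?R \<union> (+) n ` ?R \<union> {2 * n, 2 * n + 1}) = card (?R \<union> (+) n ` ?R) + card {2 * n, 2 * n + 1}"
      using finite_relevant_vars lt by (intro card_Un_disjoint) fastforce+
    ultimately show ?thesis by simp
  qed
  ultimately show ?thesis unfolding num_relevant_def by simp
qed

section \<open>Bounds on \<open>R_max\<close> and passage to the limit\<close>

lemma R_max_upper: "R_max d \<le> 6.614 * 2 ^ d"
  unfolding R_max_def
proof (rule cSup_least)
  have "is_boolean_fun 0 (\<lambda>x. 0)" "bdeg 0 (\<lambda>x. 0) \<le> d"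
    by (auto simp: is_boolean_fun_def bdeg_le_iff deg_on_def)
  then show "{real (num_relevant n f) |n f. is_boolean_fun n f \<and> bdeg n f \<le> d} \<noteq> {}" by blast
qed (use num_relevant_le in blast)

lemma num_relevant_le_R_max:
  assumes "is_boolean_fun n f" "bdeg n f \<le> d"
  shows "real (num_relevant n f) \<le> R_max d"
  unfolding R_max_def
proof (rule cSup_upper)
  show "bdd_above {real (num_relevant n f) |n f. is_boolean_fun n f \<and> bdeg n f \<le> d}"
    using num_relevant_le unfolding bdd_above_def by blast
qed (use assms in blast)

text \<open>The start of the recursion at degree 1, and a witness with a relevant variable at every
  positive degree.\<close>

lemma dictator:
  assumes "1 \<le> d"
  shows "is_boolean_fun 1 (\<lambda>x. of_bool (0 \<in> x))" "bdeg 1 (\<lambda>x. of_bool (0 \<in> x)) \<le> d"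
    "num_relevant 1 (\<lambda>x. of_bool (0 \<in> x)) = 1"
proof -
  show "is_boolean_fun 1 (\<lambda>x. of_bool (0 \<in> x))" by (simp add: is_boolean_fun_def)
  show "bdeg 1 (\<lambda>x. of_bool (0 \<in> x)) \<le> d" unfolding bdeg_le_iff
    by (rule deg_on_of_deg_le[OF deg_le_var[OF assms]]) auto
  have "relevant_vars 1 (\<lambda>x. of_bool (0 \<in> x)) = {0}"
    by (auto simp: relevant_vars_iff)
  then show "num_relevant 1 (\<lambda>x. of_bool (0 \<in> x)) = 1" by (simp add: num_relevant_def)
qed

lemma R_max_doubling:
  assumes "1 \<le> d"
  shows "2 * R_max d + 2 \<le> R_max (Suc d)"
proof -
  have step: "2 * real (num_relevant n f) + 2 \<le> R_max (Suc d)"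
    if f: "is_boolean_fun n f" "bdeg n f \<le> d" and "num_relevant n f \<noteq> 0" for n f
  proof -
    have "real (2 * num_relevant n f + 2) \<le> real (num_relevant (2 * n + 2) (selector n f))"
      using selector_relevant that by (simp only: of_nat_le_iff)
    also have "\<dots> \<le> R_max (Suc d)"
      using f by (intro num_relevant_le_R_max selector_boolean selector_degree)
    finally show ?thesis by simp
  qed
  \<comment> \<open>If \<open>f\<close> has no relevant variable, doubling the dictator gives
    \<open>4 \<le> R_max (Suc d)\<close>, which suffices.\<close>
  have "real (num_relevant n f) \<le> (R_max (Suc d) - 2) / 2" if "is_boolean_fun n f" "bdeg n f \<le> d" for n f
    using step[OF that] step[OF dictator(1,2)[OF assms]] dictator(3)[OF assms]
    by (cases "num_relevant n f = 0") auto
  then have "R_max d \<le> (R_max (Suc d) - 2) / 2"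
    unfolding R_max_def[of d] using dictator(1,2)[OF assms] by (intro cSup_least) blast+
  then show ?thesis by simp
qed

lemma C_const_step:
  assumes "1 \<le> d"
  shows "C_const d + 1 / 2 ^ d \<le> C_const (Suc d)"
proof -
  have "(2 * R_max d + 2) / 2 ^ Suc d \<le> R_max (Suc d) / 2 ^ Suc d"
    using R_max_doubling[OF assms] by (intro divide_right_mono) auto
  then show ?thesis unfolding C_const_def by (simp add: add_divide_distrib)
qed

text \<open>Start from 1 / 2 at degree 1 and add the increments 1 / 2^k for k from 1 to d - 1, which
  sum to 1 - 2 / 2^d.\<close>

lemma C_const_lower: "1 \<le> d \<Longrightarrow> 3 / 2 - 2 / 2 ^ d \<le> C_const d"
proof (induction d rule: dec_induct)
  case base
  have "1 \<le> R_max 1" using num_relevant_le_R_max[OF dictator(1,2)] dictator(3) by (metis of_nat_1 order_refl)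
  then show ?case by (simp add: C_const_def)
next
  case (step d)
  have "3 / 2 - 2 / 2 ^ Suc d = 3 / 2 - 2 / 2 ^ d + 1 / (2 :: real) ^ d" by (simp add: field_simps)
  then show ?case using C_const_step[OF step.hyps(1)] step.IH by linarith
qed

theorem theorem2:
  shows "\<exists>L. C_const \<longlonglongrightarrow> L \<and> 3 / 2 \<le> L \<and> L \<le> (6.614 :: real)"
proof -
  \<comment> \<open>\<open>C_const_step\<close> starts at degree 1, so monotone convergence is
    applied to the shifted sequence.\<close>
  define c where "c d = C_const (Suc d)" for d
  have upper: "c d \<le> 6.614" for d
    using R_max_upper[of "Suc d"] unfolding c_def C_const_def by (simp add: divide_le_eq)
  have "c d \<le> c (Suc d)" for d
  proof -
    have "(0 :: real) \<le> 1 / 2 ^ Suc d" by simp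
    then show ?thesis using C_const_step[of "Suc d"] unfolding c_def by linarith
  qed
  then have "incseq c" by (rule incseq_SucI)
  then obtain L where L: "c \<longlonglongrightarrow> L" using incseq_convergent upper by blast
  have "C_const \<longlonglongrightarrow> L" using L unfolding c_def by (rule LIMSEQ_imp_Suc)
  moreover have "L \<le> 6.614" using L upper by (intro LIMSEQ_le_const2) auto
  moreover have "3 / 2 \<le> L"
  proof (rule LIMSEQ_le[OF _ L])
    have "(\<lambda>d. 3 / 2 - (1 / 2 :: real) ^ d) \<longlonglongrightarrow> 3 / 2 - 0"
      by (intro tendsto_intros LIMSEQ_power_zero) simp
    then show "(\<lambda>d. 3 / 2 - (1 / 2 :: real) ^ d) \<longlonglongrightarrow> 3 / 2" by simp
    show "\<exists>N. \<forall>d\<ge>N. 3 / 2 - (1 / 2) ^ d \<le> c d"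
      using C_const_lower[of "Suc _"] unfolding c_def by (auto simp: power_one_over)
  qed
  ultimately show ?thesis by blast
qed

end
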